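(* The generating function $\sum_{n\ge0}|\operatorname{Av}_n(231)^{+1}|x^n$ of the permutations that almost avoid $231$ is $$\frac{1-5x-6x^2+45x^3-24x^4-(1+x-4x^2+x^3)(1-4x)^{3/2}}{-2x^2(1-4x)^{3/2}}.$$
   Context: A permutation $\pi$ contains $\sigma$ if $\pi$ has a subsequence order isomorphic to $\sigma$; otherwise $\pi$ avoids $\sigma$. A permutation almost avoids $231$ if one can remove at most one entry from it to obtain a $231$-avoiding permutation; $\operatorname{Av}_n(231)^{+1}$ denotes the set of such permutations of length $n$ (the empty permutation counts for $n=0$). *)

theory Defs
  imports
    Complex_Main
    "HOL-Library.Sublist"
    "HOL-Combinatorics.Multiset_Permutations"
    "HOL-Computational_Algebra.Formal_Laurent_Series"
begin

text \<open>
  Permutations of length \<open>n\<close> are written in one-line notation, as the lists in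
  \<^term>\<open>permutations_of_set {1..n::nat}\<close>.
\<close>

definition order_isomorphic :: "nat list \<Rightarrow> nat list \<Rightarrow> bool" where
  "order_isomorphic u v \<longleftrightarrow>
     length u = length v \<and>
     (\<forall>i<length u. \<forall>j<length u. u ! i < u ! j \<longleftrightarrow> v ! i < v ! j)"

definition contains_pattern :: "nat list \<Rightarrow> nat list \<Rightarrow> bool" where
  "contains_pattern p s \<longleftrightarrow> (\<exists>u. subseq u p \<and> order_isomorphic u s)"

abbreviation avoids_pattern :: "nat list \<Rightarrow> nat list \<Rightarrow> bool" where
  "avoids_pattern p s \<equiv> \<not> contains_pattern p s"

definition remove_entry :: "nat \<Rightarrow> nat list \<Rightarrow> nat list" where
  "remove_entry i p = take i p @ drop (Suc i) p"

text \<open>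
  Deleting an entry of a permutation leaves a word of distinct numbers, which is regarded as
  the permutation order isomorphic to it: each entry is replaced by its rank.
\<close>

definition standardize :: "nat list \<Rightarrow> nat list" where
  "standardize w = map (\<lambda>x. card {y \<in> set w. y \<le> x}) w"

definition almost_avoids :: "nat list \<Rightarrow> nat list \<Rightarrow> bool" where
  "almost_avoids p s \<longleftrightarrow>
     avoids_pattern p s \<or>
     (\<exists>i<length p. avoids_pattern (standardize (remove_entry i p)) s)"

definition Av_plus1 :: "nat \<Rightarrow> nat list \<Rightarrow> nat list set" where
  "Av_plus1 n s = {p \<in> permutations_of_set {1..n}. almost_avoids p s}"

text \<open>
  \<^term>\<open>fps_binomial a\<close> is the binomial series of \<open>(1 + x)\<close> to the power \<open>a\<close>; substituting
  \<open>-4x\<close> for \<open>x\<close> gives \<open>(1 - 4x)\<close> to the power \<open>3/2\<close>, with constant term 1.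
\<close>

definition one_minus_4x_pow_three_halves :: "real fps" where
  "one_minus_4x_pow_three_halves = fps_binomial (3/2) oo (- 4 * fps_X)"

end

theory Submission
  imports Defs
begin


text \<open>
  Split a permutation at its maximum, as \<open>L N R\<close>. It avoids 231 iff \<open>L\<close> and \<open>R\<close> do and all entries
  of \<open>L\<close> lie below all entries of \<open>R\<close>; this gives the Catalan series \<open>C = 1 + x C\<^sup>2\<close>. If \<open>L\<close> lies below
  \<open>R\<close>, the permutation almost avoids 231 iff one of \<open>L\<close>, \<open>R\<close> avoids it and the other almost avoids
  it. Otherwise every pair \<open>l > r\<close> with \<open>l\<close> in \<open>L\<close> and \<open>r\<close> in \<open>R\<close> gives an occurrence \<open>l N r\<close>, so the
  removed entry is \<open>N\<close>, or the only entry of \<open>L\<close> above some entry of \<open>R\<close>, or the only entry of \<open>R\<close>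
  below some entry of \<open>L\<close>. Each of these three cases and each of their intersections is a product of
  231-avoiding pieces, and inclusion-exclusion expresses the generating function through \<open>C\<close> and its
  derivative. Finally \<open>1 - 2 x C\<close> is the square root of \<open>1 - 4 x\<close>.
\<close>

section \<open>Avoiding and almost avoiding 231\<close>

text \<open>An occurrence is listed by position as \<open>[b, c, a]\<close>, while the letters
  \<open>a\<close>, \<open>b\<close>, \<open>c\<close> follow the order of the values.\<close>

definition av231 :: "nat list \<Rightarrow> bool" where
  "av231 p \<longleftrightarrow> (\<forall>a b c. subseq [b, c, a] p \<longrightarrow> a < b \<longrightarrow> \<not> b < c)"

text \<open>Deletion is by value: in a word with distinct entries this is deletion of one position,
  and a value \<open>x\<close> absent from \<open>p\<close> accounts for deleting nothing.\<close>

definition almost_av231 :: "nat list \<Rightarrow> bool" where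
  "almost_av231 p \<longleftrightarrow> (\<exists>x. av231 (removeAll x p))"

lemma subseq2_Cons: "subseq [x, y] (z # R) \<longleftrightarrow> x = z \<and> y \<in> set R \<or> subseq [x, y] R"
  using subseq_Cons'[of y "[]"] by (auto simp: subseq_singleton_left dest: subseq_Cons')

lemma subseq3_Cons:
  "subseq [x, y, w] (z # R) \<longleftrightarrow> x = z \<and> subseq [y, w] R \<or> subseq [x, y, w] R"
  by (auto dest: subseq_Cons')

lemma subseq2_append:
  "subseq [x, y] (L @ R) \<longleftrightarrow> subseq [x, y] L \<or> subseq [x, y] R \<or> x \<in> set L \<and> y \<in> set R"
  by (induction L) (auto simp: subseq2_Cons simp del: subseq_Cons2_iff)

lemma subseq3_append:
  "subseq [x, y, z] (L @ R) \<longleftrightarrow> subseq [x, y, z] L \<or> subseq [x, y, z] R \<or>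
     subseq [x, y] L \<and> z \<in> set R \<or> x \<in> set L \<and> subseq [y, z] R"
  by (induction L) (auto simp: subseq2_Cons subseq3_Cons subseq2_append simp del: subseq_Cons2_iff)

lemma subseq2_mem: "subseq [x, y] L \<Longrightarrow> x \<in> set L \<and> y \<in> set L"
  by (induction L) (auto simp: subseq2_Cons simp del: subseq_Cons2_iff)

lemma subseq3_mem: "subseq [x, y, z] L \<Longrightarrow> x \<in> set L \<and> y \<in> set L \<and> z \<in> set L"
  by (induction L) (auto simp: subseq3_Cons simp del: subseq_Cons2_iff dest: subseq2_mem)

lemma av231_subseq: "av231 q \<Longrightarrow> subseq p q \<Longrightarrow> av231 p"
  unfolding av231_def by (meson subseq_order.order_trans)

lemma subseq_removeAll: "subseq (removeAll x p) p"
  unfolding removeAll_filter_not_eq by (rule subseq_filter_left)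

lemma avoids_231_iff: "avoids_pattern p [2, 3, 1] \<longleftrightarrow> av231 p"
proof -
  have "order_isomorphic u [2, 3, 1] \<longleftrightarrow> (\<exists>a b c. u = [b, c, a] \<and> a < b \<and> b < c)" for u
  proof
    assume o: "order_isomorphic u [2, 3, 1]"
    then have "length u = 3" by (simp add: order_isomorphic_def)
    then obtain b c a where u: "u = [b, c, a]" by (auto simp: numeral_3_eq_3 length_Suc_conv)
    have "u ! 2 < u ! 0" using o[unfolded order_isomorphic_def] \<open>length u = 3\<close> by simp
    moreover have "u ! 0 < u ! 1" using o[unfolded order_isomorphic_def] \<open>length u = 3\<close> by simp
    ultimately show "\<exists>a b c. u = [b, c, a] \<and> a < b \<and> b < c" using u by simp
  next
    assume "\<exists>a b c. u = [b, c, a] \<and> a < b \<and> b < c"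
    then show "order_isomorphic u [2, 3, 1]"
      by (auto simp: order_isomorphic_def less_Suc_eq numeral_3_eq_3)
  qed
  then have "contains_pattern p [2, 3, 1] \<longleftrightarrow> (\<exists>a b c. subseq [b, c, a] p \<and> a < b \<and> b < c)"
    unfolding contains_pattern_def by (simp only:) blast
  then show ?thesis unfolding av231_def by (simp only:) blast
qed

text \<open>Subsequences of the image are the images of subsequences, and strict monotonicity on the
  entries preserves and reflects their comparisons.\<close>

lemma av231_map:
  assumes "strict_mono_on (set w) f"
  shows "av231 (map f w) \<longleftrightarrow> av231 w"
proof -
  have *: "subseq [b, c, a] (map f w) \<longleftrightarrow>
      (\<exists>b' c' a'. subseq [b', c', a'] w \<and> b = f b' \<and> c = f c' \<and> a = f a')" for a b c
    by (auto simp: subseq_conv_nths nths_map map_eq_Cons_conv) (metis list.simps(8,9) map_eq_Cons_conv)+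
  show ?thesis
    unfolding av231_def * using assms
    by (smt (verit, best) strict_mono_on_less subseq3_mem)
qed

lemma almost_av231_iff_mem:
  "almost_av231 p \<longleftrightarrow> av231 p \<or> (\<exists>x\<in>set p. av231 (removeAll x p))"
proof -
  \<comment> \<open>Deleting an absent value leaves \<open>p\<close> itself, so it supplies the
    first disjunct.\<close>
  obtain y where "y \<notin> set p" using ex_new_if_finite[OF infinite_UNIV_nat] by blast
  then show ?thesis unfolding almost_av231_def by (metis removeAll_id)
qed

text \<open>Since \<open>f\<close> is injective on the entries, deletion commutes with relabelling.
  The form with \<open>x\<close> in \<open>set p\<close> matters, as \<open>f\<close> is controlled
  only there.\<close>

lemma almost_av231_map:
  assumes m: "strict_mono_on (set w) f"
  shows "almost_av231 (map f w) \<longleftrightarrow> almost_av231 w"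
proof -
  have "removeAll (f x) (map f w) = map f (removeAll x w)" if "x \<in> set w" for x
    using strict_mono_on_imp_inj_on[OF m] that
    by (auto simp: removeAll_filter_not_eq filter_map o_def inj_on_def
        intro!: arg_cong[where f = "map f"] filter_cong)
  moreover have "av231 (map f (removeAll x w)) = av231 (removeAll x w)" for x
    using av231_map monotone_on_subset[OF m] by (metis Diff_subset set_removeAll)
  ultimately show ?thesis
    unfolding almost_av231_iff_mem by (simp add: av231_map[OF m])
qed

lemma av231_standardize: "av231 (standardize w) \<longleftrightarrow> av231 w"
  unfolding standardize_def
proof (rule av231_map, rule strict_mono_onI)
  fix r s assume "r \<in> set w" "s \<in> set w" "r < s"
  \<comment> \<open>The inclusion is strict because \<open>s\<close> itself is counted only on the
    right; hence rank is strictly increasing on the entries.\<close>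
  then have "{y \<in> set w. y \<le> r} \<subset> {y \<in> set w. y \<le> s}"
    by (auto simp: psubset_eq set_eq_iff not_le intro!: exI[of _ s])
  then show "card {y \<in> set w. y \<le> r} < card {y \<in> set w. y \<le> s}"
    by (intro psubset_card_mono) auto
qed

lemma remove_entry_distinct:
  assumes "distinct p" "i < length p"
  shows "remove_entry i p = removeAll (p ! i) p"
proof -
  have "p = take i p @ p ! i # drop (Suc i) p" using assms(2) by (rule id_take_nth_drop)
  moreover from this assms(1) have "p ! i \<notin> set (take i p)" "p ! i \<notin> set (drop (Suc i) p)"
    by (metis distinct_append distinct.simps(2) not_distinct_conv_prefix disjoint_insert(1) list.simps(15))+
  ultimately show ?thesis unfolding remove_entry_def
    by (metis removeAll_append removeAll_id removeAll.simps(2))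
qed

lemma almost_avoids_iff:
  assumes "distinct p"
  shows "almost_avoids p [2, 3, 1] \<longleftrightarrow> almost_av231 p"
proof -
  have "(\<exists>i<length p. av231 (standardize (remove_entry i p))) \<longleftrightarrow> (\<exists>x\<in>set p. av231 (removeAll x p))"
    unfolding av231_standardize Bex_def in_set_conv_nth using remove_entry_distinct[OF assms] by metis
  then show ?thesis unfolding almost_avoids_def avoids_231_iff almost_av231_iff_mem by simp
qed

section \<open>Avoidance of 231 in concatenations\<close>

lemma av231_append:
  "av231 (L @ R) \<longleftrightarrow> av231 L \<and> av231 R \<and>
    (\<forall>b c a. subseq [b, c] L \<longrightarrow> a \<in> set R \<longrightarrow> a < b \<longrightarrow> \<not> b < c) \<and>
    (\<forall>b c a. b \<in> set L \<longrightarrow> subseq [c, a] R \<longrightarrow> a < b \<longrightarrow> \<not> b < c)"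
  unfolding av231_def subseq3_append by blast

lemma av231_Cons:
  "av231 (x # R) \<longleftrightarrow> av231 R \<and> (\<forall>c a. subseq [c, a] R \<longrightarrow> a < x \<longrightarrow> \<not> x < c)"
  unfolding av231_def subseq3_Cons by blast

text \<open>Both kinds of mixed occurrence take the middle value \<open>b\<close> from
  \<open>L\<close> and the least value \<open>a\<close> from \<open>R\<close>, so
  \<open>a < b\<close> contradicts the hypothesis.\<close>

lemma av231_append_less:
  assumes "\<forall>l\<in>set L. \<forall>r\<in>set R. l < r"
  shows "av231 (L @ R) \<longleftrightarrow> av231 L \<and> av231 R"
  proof -
  have "\<not> b < c" if "subseq [b, c] L" "a \<in> set R" "a < b" for a b c
    using that assms by (meson order_less_asym subseq2_mem)
  moreover have "\<not> b < c" if "b \<in> set L" "subseq [c, a] R" "a < b" for a b c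
    using that assms by (meson order_less_asym subseq2_mem)
  ultimately show ?thesis unfolding av231_append by blast
qed

text \<open>A pair \<open>l > r\<close> across the maximum completes to the occurrence
  \<open>l N r\<close>. Conversely, \<open>N\<close> can only be the largest letter of an
  occurrence, and the other two letters then form such a pair.\<close>

lemma av231_top:
  assumes "distinct (L @ R)" "\<forall>x\<in>set L \<union> set R. x < N"
  shows "av231 (L @ N # R) \<longleftrightarrow> av231 L \<and> av231 R \<and> (\<forall>l\<in>set L. \<forall>r\<in>set R. l < r)"
proof
  assume a: "av231 (L @ N # R)"
  have "l < r" if "l \<in> set L" "r \<in> set R" for l r
  proof -
    have "subseq [N, r] (N # R)" using that by (simp add: subseq_singleton_left)
    then have "\<not> r < l" using a that assms unfolding av231_append by blast
    moreover have "l \<noteq> r" using assms that by auto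
    ultimately show ?thesis by simp
  qed
  then show "av231 L \<and> av231 R \<and> (\<forall>l\<in>set L. \<forall>r\<in>set R. l < r)"
    using a unfolding av231_append av231_Cons by blast
next
  assume a: "av231 L \<and> av231 R \<and> (\<forall>l\<in>set L. \<forall>r\<in>set R. l < r)"
  have "av231 (N # R)" using a assms unfolding av231_Cons
    by (metis UnCI order_less_asym subseq2_mem)
  moreover have "\<not> b < c" if "subseq [b, c] L" "x \<in> set (N # R)" "x < b" for b c x
    using that a assms(2) subseq2_mem[OF that(1)] by (metis UnCI order_less_asym set_ConsD)
  moreover have "\<not> b < c" if "b \<in> set L" "subseq [c, x] (N # R)" "x < b" for b c x
    using that a assms(2) by (metis UnCI order_less_asym subseq2_Cons subseq2_mem)
  ultimately show "av231 (L @ N # R)" using a unfolding av231_append by blast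
qed


section \<open>Counting permutations of a set\<close>

definition av_count :: "nat \<Rightarrow> nat" where
  "av_count n = card {p \<in> permutations_of_set {..<n}. av231 p}"

definition almost_count :: "nat \<Rightarrow> nat" where
  "almost_count n = card {p \<in> permutations_of_set {..<n}. almost_av231 p}"

text \<open>The increasing enumeration of \<open>V\<close> carries permutations of
  \<open>{..<card V}\<close> bijectively to permutations of \<open>V\<close> and leaves
  \<open>Q\<close> unchanged.\<close>

lemma card_permutations_invariant:
  assumes fin: "finite V"
    and inv: "\<And>f w. strict_mono_on (set w) f \<Longrightarrow> Q (map f w) = Q w"
  shows "card {p \<in> permutations_of_set V. Q p} = card {p \<in> permutations_of_set {..<card V}. Q p}"
proof -
  define f where "f = (!) (sorted_list_of_set V)"
  have mono: "strict_mono_on {..<card V} f"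
    by (auto simp: f_def strict_mono_on_def intro!: sorted_wrt_nth_less[OF strict_sorted_list_of_set])
  then have inj: "inj_on f {..<card V}" by (rule strict_mono_on_imp_inj_on)
  have "f ` {..<card V} = V"
    using set_sorted_list_of_set[OF fin] length_sorted_list_of_set[of V]
    unfolding f_def by (metis atLeast0LessThan atLeast_upt list.set_map map_nth)
  then have "permutations_of_set V = map f ` permutations_of_set {..<card V}"
    using permutations_of_set_image_inj[OF inj] by simp
  moreover have "Q (map f p) = Q p" if "p \<in> permutations_of_set {..<card V}" for p
    using that mono by (intro inv) (simp add: permutations_of_set_def)
  ultimately have "{p \<in> permutations_of_set V. Q p} = map f ` {p \<in> permutations_of_set {..<card V}. Q p}"
    by auto
  moreover have "inj_on (map f) {p \<in> permutations_of_set {..<card V}. Q p}"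
    by (intro inj_on_mapI inj_on_subset[OF inj]) (auto simp: permutations_of_set_def)
  ultimately show ?thesis by (simp add: card_image)
qed

lemma card_av231: "finite V \<Longrightarrow> card {p \<in> permutations_of_set V. av231 p} = av_count (card V)"
  unfolding av_count_def
  by (rule card_permutations_invariant[where Q = av231, OF _ av231_map])

lemma card_almost_av231:
  "finite V \<Longrightarrow> card {p \<in> permutations_of_set V. almost_av231 p} = almost_count (card V)"
  unfolding almost_count_def
  by (rule card_permutations_invariant[where Q = almost_av231, OF _ almost_av231_map])

text \<open>As \<open>v\<close> occurs exactly once, the words before and after it determine the
  permutation and are determined by it.\<close>

lemma card_insert_splits:
  assumes "v \<notin> V"
  shows "card {p \<in> permutations_of_set (insert v V). Q p} =
    card {(L, R). L @ R \<in> permutations_of_set V \<and> Q (L @ v # R)}"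
proof -
  have "bij_betw (\<lambda>(L, R). L @ v # R) {(L, R). L @ R \<in> permutations_of_set V \<and> Q (L @ v # R)}
     {p \<in> permutations_of_set (insert v V). Q p}"
    unfolding bij_betw_def
  proof (intro conjI set_eqI iffI)
    show "inj_on (\<lambda>(L, R). L @ v # R) {(L, R). L @ R \<in> permutations_of_set V \<and> Q (L @ v # R)}"
    proof (rule inj_onI, clarify)
      fix L R L' R'
      assume "L @ R \<in> permutations_of_set V" "L' @ R' \<in> permutations_of_set V"
        and eq: "L @ v # R = L' @ v # R'"
      then have "v \<notin> set L" "v \<notin> set R" using assms by (auto simp: permutations_of_set_def)
      then show "L = L' \<and> R = R'" using eq by (simp add: append_Cons_eq_iff)
    qed
  next
    fix p assume p: "p \<in> {p \<in> permutations_of_set (insert v V). Q p}"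
    then have "v \<in> set p" by (auto simp: permutations_of_set_def)
    then obtain L R where "p = L @ v # R" by (meson split_list)
    moreover from this p assms have "L @ R \<in> permutations_of_set V"
      by (auto simp: permutations_of_set_def)
    ultimately show "p \<in> (\<lambda>(L, R). L @ v # R) ` {(L, R). L @ R \<in> permutations_of_set V \<and> Q (L @ v # R)}"
      using p by auto
  qed (use assms in \<open>auto simp: permutations_of_set_def\<close>)
  then show ?thesis by (simp add: bij_betw_same_card)
qed

text \<open>A word of length \<open>card V\<close> has \<open>card V + 1\<close> cut positions,
  counting the two ends.\<close>

lemma card_splits:
  assumes "finite V"
  shows "card {(L, R). L @ R \<in> permutations_of_set V \<and> Q (L @ R)} =
    Suc (card V) * card {p \<in> permutations_of_set V. Q p}"
proof -
  have len: "length p = card V" if "p \<in> permutations_of_set V" for p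
    using that by (auto simp: permutations_of_set_def distinct_card)
  have "bij_betw (\<lambda>(p, i). (take i p, drop i p)) ({p \<in> permutations_of_set V. Q p} \<times> {..card V})
     {(L, R). L @ R \<in> permutations_of_set V \<and> Q (L @ R)}"
  proof (rule bij_betw_byWitness[where f' = "\<lambda>(L, R). (L @ R, length L)"])
    show "(\<lambda>(L, R). (L @ R, length L)) ` {(L, R). L @ R \<in> permutations_of_set V \<and> Q (L @ R)}
      \<subseteq> {p \<in> permutations_of_set V. Q p} \<times> {..card V}"
      using len by fastforce
  qed (auto dest: len)
  then have "card {(L, R). L @ R \<in> permutations_of_set V \<and> Q (L @ R)} =
      card ({p \<in> permutations_of_set V. Q p} \<times> {..card V})"
    by (simp add: bij_betw_same_card)
  then show ?thesis by (simp add: card_cartesian_product)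
qed

text \<open>Such a permutation arises by inserting \<open>v\<close> at any position of an avoiding
  permutation of \<open>V\<close>.\<close>

lemma card_av231_removeAll:
  assumes "finite V" "v \<notin> V"
  shows "card {p \<in> permutations_of_set (insert v V). av231 (removeAll v p)} =
    Suc (card V) * av_count (card V)"
proof -
  have "{(L, R). L @ R \<in> permutations_of_set V \<and> av231 (removeAll v (L @ v # R))} =
        {(L, R). L @ R \<in> permutations_of_set V \<and> av231 (L @ R)}"
    using assms(2) by (auto simp: permutations_of_set_def)
  then show ?thesis
    using card_insert_splits[OF assms(2)] card_splits[OF assms(1)] card_av231[OF assms(1)] by simp
qed

section \<open>Separated pairs and the Catalan recurrence\<close>

text \<open>The products are disjoint because the entry sets of the two words recover the
  index.\<close>

lemma card_UN_Times_sets: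
  assumes fin: "finite I"
    and F: "\<And>i L. i \<in> I \<Longrightarrow> L \<in> F i \<Longrightarrow> set L = V i" "\<And>i. i \<in> I \<Longrightarrow> finite (F i)"
    and G: "\<And>i R. i \<in> I \<Longrightarrow> R \<in> G i \<Longrightarrow> set R = W i" "\<And>i. i \<in> I \<Longrightarrow> finite (G i)"
    and inj: "\<And>i j. i \<in> I \<Longrightarrow> j \<in> I \<Longrightarrow> V i = V j \<Longrightarrow> W i = W j \<Longrightarrow> i = j"
  shows "card (\<Union>i\<in>I. F i \<times> G i) = (\<Sum>i\<in>I. card (F i) * card (G i))"
proof -
  have "card (\<Union>i\<in>I. F i \<times> G i) = (\<Sum>i\<in>I. card (F i \<times> G i))"
    using assms by (intro card_UN_disjoint) (auto, metis)
  then show ?thesis by (simp add: card_cartesian_product)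
qed

lemma initial_segment:
  fixes X Y :: "nat set"
  assumes "X \<union> Y = {..<N}" "\<forall>x\<in>X. \<forall>y\<in>Y. x < y"
  obtains k where "k \<le> N" "X = {..<k}" "Y = {k..<N}"
proof -
  \<comment> \<open>The alternative \<open>k = N\<close> makes the minimum exist when
    \<open>Y\<close> is empty.\<close>
  define k where "k = (LEAST k. k = N \<or> k \<in> Y)"
  have k: "k = N \<or> k \<in> Y" unfolding k_def by (rule LeastI[of _ N]) simp
  have less: "j < k \<Longrightarrow> j \<noteq> N \<and> j \<notin> Y" for j unfolding k_def by (drule not_less_Least) simp
  have Y: "y < N" if "y \<in> Y" for y using that assms(1) by auto
  have kN: "k \<le> N" using k Y less_imp_le by blast
  then have X: "X = {..<k}" using assms k less by (auto simp: set_eq_iff)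
  then have "y \<in> Y" if "y \<in> {k..<N}" for y
    using that equalityD2[OF assms(1)] by (auto simp: subset_iff)
  moreover have "k \<le> y" if "y \<in> Y" for y using that less not_le by blast
  ultimately have "y \<in> Y \<longleftrightarrow> y \<in> {k..<N}" for y using Y by (metis atLeastLessThan_iff)
  then show ?thesis using that kN X by blast
qed

text \<open>Separation forces \<open>L\<close> to use an initial segment \<open>{..<k}\<close> and
  \<open>R\<close> the rest. The counts depend only on the sizes of these sets, so a convolution
  results.\<close>

lemma card_separated:
  assumes "\<And>V. finite V \<Longrightarrow> card {p \<in> permutations_of_set V. P p} = f (card V)"
    and "\<And>V. finite V \<Longrightarrow> card {p \<in> permutations_of_set V. Q p} = g (card V)"
  shows "card {(L, R). L @ R \<in> permutations_of_set {..<N} \<and>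
      (\<forall>l\<in>set L. \<forall>r\<in>set R. l < r) \<and> P L \<and> Q R} = (\<Sum>k\<le>N. f k * g (N - k))"
proof -
  have "{(L, R). L @ R \<in> permutations_of_set {..<N} \<and> (\<forall>l\<in>set L. \<forall>r\<in>set R. l < r) \<and> P L \<and> Q R} =
    (\<Union>k\<in>{..N}. {p \<in> permutations_of_set {..<k}. P p} \<times> {p \<in> permutations_of_set {k..<N}. Q p})"
    (is "?A = ?B")
  proof (intro subset_antisym subsetI)
    fix z assume "z \<in> ?A"
    then obtain L R where z: "z = (L, R)" "P L" "Q R" "distinct (L @ R)" "set L \<union> set R = {..<N}"
      "\<forall>l\<in>set L. \<forall>r\<in>set R. l < r" by (auto simp: permutations_of_set_def)
    from initial_segment[OF z(5,6)] obtain k where "k \<le> N" "set L = {..<k}" "set R = {k..<N}" .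
    then show "z \<in> ?B" using z by (auto simp: permutations_of_set_def)
  qed (auto simp: permutations_of_set_def)
  also have "card \<dots> = (\<Sum>k\<le>N. f k * g (N - k))"
    by (subst card_UN_Times_sets[where V = "\<lambda>k. {..<k}" and W = "\<lambda>k. {k..<N}"])
       (simp_all add: assms, auto dest: permutations_of_setD)
  finally show ?thesis .
qed

lemma av_count_Suc: "av_count (Suc N) = (\<Sum>k\<le>N. av_count k * av_count (N - k))"
proof -
  have "av_count (Suc N) = card {p \<in> permutations_of_set (insert N {..<N}). av231 p}"
    by (simp add: av_count_def lessThan_Suc)
  also have "\<dots> = card {(L, R). L @ R \<in> permutations_of_set {..<N} \<and> av231 (L @ N # R)}"
    by (rule card_insert_splits) simp
  also have "{(L, R). L @ R \<in> permutations_of_set {..<N} \<and> av231 (L @ N # R)} =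
     {(L, R). L @ R \<in> permutations_of_set {..<N} \<and> (\<forall>l\<in>set L. \<forall>r\<in>set R. l < r) \<and> av231 L \<and> av231 R}"
  proof -
    have "av231 (L @ N # R) \<longleftrightarrow> (\<forall>l\<in>set L. \<forall>r\<in>set R. l < r) \<and> av231 L \<and> av231 R"
      if "L @ R \<in> permutations_of_set {..<N}" for L R
      using that by (subst av231_top) (auto simp: permutations_of_set_def)
    then show ?thesis by blast
  qed
  also have "card \<dots> = (\<Sum>k\<le>N. av_count k * av_count (N - k))"
    by (rule card_separated) (simp_all add: card_av231)
  finally show ?thesis .
qed

lemma av_count_0: "av_count 0 = 1"
proof -
  have "{p \<in> permutations_of_set {..<0}. av231 p} = {[]}" by (auto simp: av231_def)
  then show ?thesis by (simp add: av_count_def)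
qed


section \<open>Splitting at the maximum\<close>

definition separated :: "nat list \<Rightarrow> nat list \<Rightarrow> bool" where
  "separated L R \<longleftrightarrow> (\<forall>l\<in>set L. \<forall>r\<in>set R. l < r)"

text \<open>
  A pair \<open>(L, R)\<close> stands for the permutation \<open>L @ N # R\<close>. In the next three sets it is not separated,
  and becomes 231-avoiding when one removes \<open>N\<close>, an entry of \<open>L\<close>, or an entry of \<open>R\<close>, respectively.
\<close>

definition top_removable :: "nat \<Rightarrow> (nat list \<times> nat list) set" where
  "top_removable N = {(L, R). L @ R \<in> permutations_of_set {..<N} \<and> \<not> separated L R \<and> av231 (L @ R)}"

definition left_removable :: "nat \<Rightarrow> (nat list \<times> nat list) set" where
  "left_removable N = {(L, R). L @ R \<in> permutations_of_set {..<N} \<and> \<not> separated L R \<and>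
     (\<exists>x\<in>set L. av231 (removeAll x L) \<and> av231 R \<and> separated (removeAll x L) R)}"

definition right_removable :: "nat \<Rightarrow> (nat list \<times> nat list) set" where
  "right_removable N = {(L, R). L @ R \<in> permutations_of_set {..<N} \<and> \<not> separated L R \<and>
     (\<exists>x\<in>set R. av231 L \<and> av231 (removeAll x R) \<and> separated L (removeAll x R))}"

lemma av231_removeAll: "av231 p \<Longrightarrow> av231 (removeAll x p)"
  by (rule av231_subseq[OF _ subseq_removeAll])

lemma separated_removeAll: "separated L R \<Longrightarrow> separated (removeAll x L) (removeAll y R)"
  by (auto simp: separated_def)

lemma av231_imp_almost: "av231 p \<Longrightarrow> almost_av231 p"
  unfolding almost_av231_def using av231_removeAll by (intro exI)

lemma av231_top_removeAll:
  assumes "L @ R \<in> permutations_of_set {..<N}"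
  shows "av231 (removeAll x L @ N # removeAll x R) \<longleftrightarrow>
    av231 (removeAll x L) \<and> av231 (removeAll x R) \<and> separated (removeAll x L) (removeAll x R)"
  unfolding separated_def
proof (rule av231_top)
  show "distinct (removeAll x L @ removeAll x R)"
    using assms by (auto simp: permutations_of_set_def distinct_removeAll)
  show "\<forall>y\<in>set (removeAll x L) \<union> set (removeAll x R). y < N"
    using permutations_of_setD(1)[OF assms] by auto
qed

lemma almost_av231_top:
  assumes "L @ R \<in> permutations_of_set {..<N}"
  shows "almost_av231 (L @ N # R) \<longleftrightarrow> av231 (L @ R) \<or>
    (\<exists>x. av231 (removeAll x L) \<and> av231 (removeAll x R) \<and> separated (removeAll x L) (removeAll x R))"
proof -
  have N: "N \<notin> set L" "N \<notin> set R" using permutations_of_setD(1)[OF assms] by auto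
  have "av231 (removeAll x (L @ N # R)) \<longleftrightarrow> (if x = N then av231 (L @ R) else
     av231 (removeAll x L) \<and> av231 (removeAll x R) \<and> separated (removeAll x L) (removeAll x R))" for x
    using av231_top_removeAll[OF assms, of x] N by (simp add: removeAll_id)
  \<comment> \<open>For \<open>x = N\<close> both sides are unchanged, and the right-hand condition
    already implies that \<open>L @ R\<close> avoids 231. The existential may therefore range over
    all \<open>x\<close>.\<close>
  moreover have "av231 (L @ R)" if "av231 (removeAll N L)" "av231 (removeAll N R)"
      "separated (removeAll N L) (removeAll N R)"
    using that N av231_append_less[of L R] by (simp add: removeAll_id separated_def)
  ultimately show ?thesis unfolding almost_av231_def by metis
qed

text \<open>A deleted value meets at most one side, so the other side must already avoid 231;
  deletion preserves separation.\<close>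

lemma almost_av231_top_separated:
  assumes p: "L @ R \<in> permutations_of_set {..<N}" and s: "separated L R"
  shows "almost_av231 (L @ N # R) \<longleftrightarrow> almost_av231 L \<and> av231 R \<or> av231 L \<and> almost_av231 R"
proof -
  have disj: "x \<notin> set L \<or> x \<notin> set R" for x using s by (auto simp: separated_def)
  have 1: "av231 (L @ R) \<longleftrightarrow> av231 L \<and> av231 R"
    using s by (intro av231_append_less) (simp add: separated_def)
  have "(\<exists>x. av231 (removeAll x L) \<and> av231 (removeAll x R)) \<longleftrightarrow>
      almost_av231 L \<and> av231 R \<or> av231 L \<and> almost_av231 R"
    using disj unfolding almost_av231_iff_mem by (metis av231_removeAll removeAll_id)
  then show ?thesis
    unfolding almost_av231_top[OF p] 1 using separated_removeAll[OF s] av231_imp_almost by blast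
qed

text \<open>A deletion that restores separation must hit \<open>L\<close> or \<open>R\<close>, and
  by disjointness it leaves the other side intact.\<close>

lemma almost_av231_top_crossing:
  assumes p: "L @ R \<in> permutations_of_set {..<N}" and s: "\<not> separated L R"
  shows "almost_av231 (L @ N # R) \<longleftrightarrow>
    (L, R) \<in> top_removable N \<union> left_removable N \<union> right_removable N"
proof -
  have disj: "x \<notin> set L \<or> x \<notin> set R" for x using p by (auto simp: permutations_of_set_def)
  have "(\<exists>x. av231 (removeAll x L) \<and> av231 (removeAll x R) \<and> separated (removeAll x L) (removeAll x R)) \<longleftrightarrow>
     (L, R) \<in> left_removable N \<union> right_removable N"
    unfolding left_removable_def right_removable_def using p s disj
    by simp (metis removeAll_id)
  then show ?thesis
    unfolding almost_av231_top[OF p] using p s by (auto simp: top_removable_def)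
qed

section \<open>Entry sets of crossing pairs\<close>

text \<open>Here \<open>v\<close> is the removed entry and \<open>k\<close> the number of remaining
  entries of \<open>L\<close>. These form an initial segment, and \<open>k < v\<close> says that the
  least entry \<open>k\<close> of \<open>R\<close> lies below \<open>v\<close>.\<close>

lemma left_removable_iff:
  "(L, R) \<in> left_removable N \<longleftrightarrow> (\<exists>k v. k < v \<and> v < N \<and>
     L \<in> permutations_of_set (insert v {..<k}) \<and> av231 (removeAll v L) \<and>
     R \<in> permutations_of_set ({k..<N} - {v}) \<and> av231 R)" (is "?l \<longleftrightarrow> ?r")
proof
  assume ?l
  then obtain x where x: "x \<in> set L" "av231 (removeAll x L)" "av231 R" "separated (removeAll x L) R"
    and p: "L @ R \<in> permutations_of_set {..<N}" and s: "\<not> separated L R"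
    by (auto simp: left_removable_def)
  have d: "distinct L" "distinct R" "set L \<inter> set R = {}" "set L \<union> set R = {..<N}"
    using p by (auto simp: permutations_of_set_def)
  obtain l r where l: "l \<in> set L" "\<not> l < r" and r: "r \<in> set R"
    using s by (auto simp: separated_def)
  have "l = x" using x(4) l r by (auto simp: separated_def)
  then have r: "r \<in> set R" "r < x" using l r d(3) by (auto simp: not_less order_less_le)
  \<comment> \<open>Moving \<open>x\<close> from the left entry set to the right one makes the two
    sets separated, so they are complementary segments.\<close>
  have "(set L - {x}) \<union> insert x (set R) = {..<N}" using d(4) x(1) by auto
  moreover have "\<forall>a\<in>set L - {x}. \<forall>b\<in>insert x (set R). a < b"
    using x(4) r unfolding separated_def set_removeAll by (metis insertE less_trans)
  ultimately obtain k where k: "set L - {x} = {..<k}" "insert x (set R) = {k..<N}"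
    by (rule initial_segment)
  have "x \<notin> set R" using x(1) d(3) by auto
  then have "set L = insert x {..<k}" "set R = {k..<N} - {x}" using k x(1) by auto
  moreover have "r \<in> {k..<N}" using r k(2) by blast
  then have "k < x" using r by simp
  moreover have "x < N" using d(4) x(1) by auto
  ultimately show ?r using x d by (auto simp: permutations_of_set_def)
next
  assume ?r
  then obtain k v where kv: "k < v" "v < N" "set L = insert v {..<k}" "set R = {k..<N} - {v}"
    "distinct L" "distinct R" "av231 (removeAll v L)" "av231 R"
    by (auto simp: permutations_of_set_def)
  have "v \<in> set L" "k \<in> set R" using kv by auto
  then have "\<not> separated L R" using kv(1) unfolding separated_def by (meson less_asym)
  moreover have "separated (removeAll v L) R" using kv(3,4) by (auto simp: separated_def)
  moreover have "set L \<union> set R = {..<N}" "set L \<inter> set R = {}"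
    unfolding kv(3,4) using kv(1,2) by auto
  then have "L @ R \<in> permutations_of_set {..<N}"
    using kv(5,6) by (simp add: permutations_of_set_def)
  ultimately show ?l using kv \<open>v \<in> set L\<close> by (auto simp: left_removable_def)
qed

text \<open>The mirror case: \<open>v\<close> is the removed entry of \<open>R\<close>, and
  \<open>k\<close>, the largest entry of \<open>L\<close>, lies above it.\<close>

lemma right_removable_iff:
  "(L, R) \<in> right_removable N \<longleftrightarrow> (\<exists>k v. v < k \<and> k < N \<and>
     L \<in> permutations_of_set ({..k} - {v}) \<and> av231 L \<and>
     R \<in> permutations_of_set (insert v {k<..<N}) \<and> av231 (removeAll v R))" (is "?l \<longleftrightarrow> ?r")
proof
  assume ?l
  then obtain x where x: "x \<in> set R" "av231 (removeAll x R)" "av231 L" "separated L (removeAll x R)"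
    and p: "L @ R \<in> permutations_of_set {..<N}" and s: "\<not> separated L R"
    by (auto simp: right_removable_def)
  have d: "distinct L" "distinct R" "set L \<inter> set R = {}" "set L \<union> set R = {..<N}"
    using p by (auto simp: permutations_of_set_def)
  obtain l r where l: "l \<in> set L" and r: "r \<in> set R" "\<not> l < r"
    using s by (auto simp: separated_def)
  have "r = x" using x(4) l r by (auto simp: separated_def)
  then have l: "l \<in> set L" "x < l" using l r d(3) by (auto simp: not_less order_less_le)
  have "insert x (set L) \<union> (set R - {x}) = {..<N}" using d(4) x(1) by auto
  moreover have "\<forall>a\<in>insert x (set L). \<forall>b\<in>set R - {x}. a < b"
    using x(4) l unfolding separated_def set_removeAll by (metis insertE less_trans)
  ultimately obtain k' where k': "k' \<le> N" "insert x (set L) = {..<k'}" "set R - {x} = {k'..<N}"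
    by (rule initial_segment)
  then have "x \<in> {..<k'}" by blast
  \<comment> \<open>The segment contains \<open>x\<close>, so its length is positive;
    \<open>k\<close> is its last element.\<close>
  then obtain k where k: "k' = Suc k" by (cases k') auto
  have "x \<notin> set L" using x(1) d(3) by auto
  then have "set L = {..k} - {x}" using k'(2) unfolding k by (auto simp: lessThan_Suc_atMost)
  moreover have "set R = insert x {k<..<N}"
    using k'(3) x(1) unfolding k by (auto simp: atLeastSucLessThan_greaterThanLessThan)
  moreover have "l \<in> {..<Suc k}" using l k'(2) unfolding k by blast
  then have "x < k" using l by simp
  moreover have "k < N" using k'(1) k by simp
  ultimately show ?r using x d by (auto simp: permutations_of_set_def)
next
  assume ?r
  then obtain k v where kv: "v < k" "k < N" "set L = {..k} - {v}" "set R = insert v {k<..<N}"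
    "distinct L" "distinct R" "av231 L" "av231 (removeAll v R)"
    by (auto simp: permutations_of_set_def)
  have "v \<in> set R" "k \<in> set L" using kv by auto
  then have "\<not> separated L R" using kv(1) unfolding separated_def by (meson less_asym)
  moreover have "separated L (removeAll v R)" using kv(3,4) by (auto simp: separated_def)
  moreover have "set L \<union> set R = {..<N}" "set L \<inter> set R = {}"
    unfolding kv(3,4) using kv(1,2) by auto
  then have "L @ R \<in> permutations_of_set {..<N}"
    using kv(5,6) by (simp add: permutations_of_set_def)
  ultimately show ?l using kv \<open>v \<in> set R\<close> by (auto simp: right_removable_def)
qed

text \<open>In a mixed occurrence the middle value lies in \<open>L\<close> above an entry of
  \<open>R\<close>, so it is \<open>v\<close>. No later entry of \<open>L\<close> exceeds
  \<open>v\<close>, so the other two letters lie in \<open>R\<close> and the occurrence is one of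
  \<open>v # R\<close>.\<close>

lemma av231_append_max:
  assumes v: "v \<in> set L" and less: "\<forall>x\<in>set L - {v}. \<forall>y\<in>set R. x < y" and max: "\<forall>x\<in>set L. x \<le> v"
  shows "av231 (L @ R) \<longleftrightarrow> av231 L \<and> av231 (v # R)"
proof
  assume a: "av231 (L @ R)"
  then show "av231 L \<and> av231 (v # R)" using v unfolding av231_append av231_Cons by blast
next
  assume a: "av231 L \<and> av231 (v # R)"
  have "\<not> b < c" if "subseq [b, c] L" "x \<in> set R" "x < b" for b c x
  proof -
    from subseq2_mem[OF that(1)] have "b \<in> set L" "c \<in> set L" by auto
    then have "b = v" using less that by (meson DiffI less_asym singletonD)
    then show ?thesis using max \<open>c \<in> set L\<close> by (simp add: leD)
  qed
  moreover have "\<not> b < c" if "b \<in> set L" "subseq [c, x] R" "x < b" for b c x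
  proof -
    from subseq2_mem[OF that(2)] have "b = v" using less that by (meson DiffI less_asym singletonD)
    then show ?thesis using that a unfolding av231_Cons by blast
  qed
  ultimately show "av231 (L @ R)" using a unfolding av231_append av231_Cons by blast
qed

text \<open>With \<open>v\<close> leading \<open>R\<close>, all of \<open>L @ [v]\<close> lies below
  the remainder of \<open>R\<close>, and the two pieces become independent. The witness
  \<open>l\<close> gives \<open>v < l < y\<close> for each later entry \<open>y\<close>.\<close>

lemma av231_append_min:
  assumes v: "v \<in> set R" and less: "\<forall>x\<in>set L. \<forall>y\<in>set R - {v}. x < y"
    and l: "l \<in> set L" "v < l" and d: "distinct R"
  shows "av231 (L @ R) \<longleftrightarrow> (\<exists>R'. R = v # R' \<and> av231 (L @ [v]) \<and> av231 R')"
proof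
  assume a: "av231 (L @ R)"
  \<comment> \<open>An entry \<open>c\<close> of \<open>R\<close> before \<open>v\<close> would give the occurrence \<open>l c v\<close>.\<close>
  obtain R1 R2 where R: "R = R1 @ v # R2" using split_list[OF v] by (elim exE)
  have "R1 = []"
  proof (rule ccontr)
    assume "R1 \<noteq> []"
    then obtain c where c: "c \<in> set R1" by (cases R1) auto
    then have "l < c" using less l(1) d unfolding R by auto
    moreover have "subseq [c, v] R" using c unfolding R by (simp add: subseq2_append)
    ultimately show False using a l unfolding av231_append by blast
  qed
  moreover have "av231 ((L @ [v]) @ R2)" using a R \<open>R1 = []\<close> by simp
  then have "av231 (L @ [v])" "av231 R2" unfolding av231_append[of "L @ [v]"] by blast+
  ultimately show "\<exists>R'. R = v # R' \<and> av231 (L @ [v]) \<and> av231 R'" using R by simp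
next
  assume "\<exists>R'. R = v # R' \<and> av231 (L @ [v]) \<and> av231 R'"
  then obtain R' where R: "R = v # R'" "av231 (L @ [v])" "av231 R'" by blast
  have "v < y" if "y \<in> set R'" for y using less l d R(1) that less_trans by fastforce
  then have "av231 ((L @ [v]) @ R')" using R less d by (subst av231_append_less) auto
  then show "av231 (L @ R)" using R(1) by simp
qed


section \<open>Cardinalities\<close>

text \<open>Common counting scheme for the crossing cases: each \<open>(k, v)\<close> contributes a
  product of two families of words, and the entry sets recover \<open>(k, v)\<close>.\<close>

lemma card_pairs:
  fixes N :: nat and J :: "nat \<Rightarrow> nat set" and S :: "(nat list \<times> nat list) set"
  assumes J: "\<And>k. k < N \<Longrightarrow> finite (J k)"
    and S: "\<And>L R. (L, R) \<in> S \<longleftrightarrow> (\<exists>k v. k < N \<and> v \<in> J k \<and> L \<in> F k v \<and> R \<in> G k v)"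
    and F: "\<And>k v. k < N \<Longrightarrow> v \<in> J k \<Longrightarrow> F k v \<subseteq> permutations_of_set (V k v)"
    and G: "\<And>k v. k < N \<Longrightarrow> v \<in> J k \<Longrightarrow> G k v \<subseteq> permutations_of_set (W k v)"
    and inj: "\<And>k v k' v'. k < N \<Longrightarrow> v \<in> J k \<Longrightarrow> k' < N \<Longrightarrow> v' \<in> J k' \<Longrightarrow>
      V k v = V k' v' \<Longrightarrow> W k v = W k' v' \<Longrightarrow> k = k' \<and> v = v'"
  shows "card S = (\<Sum>k<N. \<Sum>v\<in>J k. card (F k v) * card (G k v))"
proof -
  have fin: "finite (permutations_of_set A)" for A :: "nat set" by simp
  have "S = (\<Union>i\<in>Sigma {..<N} J. F (fst i) (snd i) \<times> G (fst i) (snd i))"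
    using S by (auto simp: set_eq_iff)
  also have "card \<dots> = (\<Sum>i\<in>Sigma {..<N} J. card (F (fst i) (snd i)) * card (G (fst i) (snd i)))"
  proof (rule card_UN_Times_sets[where V = "\<lambda>i. V (fst i) (snd i)" and W = "\<lambda>i. W (fst i) (snd i)"])
    show "finite (Sigma {..<N} J)" by (rule finite_SigmaI) (simp_all add: J)
    show "finite (F (fst i) (snd i))" "finite (G (fst i) (snd i))" if "i \<in> Sigma {..<N} J" for i
      using that F G finite_subset[OF _ fin] by (metis SigmaE fst_conv lessThan_iff snd_conv)+
    show "set L = V (fst i) (snd i)" if "i \<in> Sigma {..<N} J" "L \<in> F (fst i) (snd i)" for i L
      using that F by (auto simp: permutations_of_set_def subset_iff)
    show "set L = W (fst i) (snd i)" if "i \<in> Sigma {..<N} J" "L \<in> G (fst i) (snd i)" for i L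
      using that G by (auto simp: permutations_of_set_def subset_iff)
    show "i = j" if "i \<in> Sigma {..<N} J" "j \<in> Sigma {..<N} J" "V (fst i) (snd i) = V (fst j) (snd j)"
      "W (fst i) (snd i) = W (fst j) (snd j)" for i j
      using inj[of "fst i" "snd i" "fst j" "snd j"] that by (auto simp: prod_eq_iff)
  qed
  also have "\<dots> = (\<Sum>k<N. \<Sum>v\<in>J k. card (F k v) * card (G k v))"
    using J by (subst sum.Sigma) (auto simp: split_def)
  finally show ?thesis .
qed

text \<open>The size of the set gives \<open>k\<close>; then \<open>v\<close> is its only element
  that is not below \<open>k\<close>.\<close>

lemma left_sets_inj:
  assumes "k < v" "k' < v'" "insert v {..<k} = insert v' {..<k'::nat}"
  shows "k = k' \<and> v = v'"
proof -
  have "card (insert v {..<k}) = Suc k" "card (insert v' {..<k'}) = Suc k'" using assms(1,2) by auto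
  then have "k = k'" using assms(3) by simp
  then show ?thesis using assms by (metis insert_iff lessThan_iff less_asym)
qed

lemma right_sets_inj:
  assumes "v < k" "v' < k'" "{..k} - {v} = {..k'::nat} - {v'}"
  shows "k = k' \<and> v = v'"
proof -
  have "card ({..k} - {v}) = k" "card ({..k'} - {v'}) = k'" using assms(1,2) by auto
  then have "k = k'" using assms(3) by simp
  moreover have "v \<in> {..k}" "v \<notin> {..k} - {v}" using assms(1) by auto
  ultimately show ?thesis using assms(3) by blast
qed

text \<open>For each \<open>k\<close> there are \<open>N - 1 - k\<close> values \<open>v\<close>,
  all with the same contribution: \<open>v\<close> enters an avoiding word on \<open>k\<close>
  letters at any of \<open>k + 1\<close> places, and \<open>R\<close> avoids on
  \<open>N - 1 - k\<close> letters.\<close>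

lemma card_left_removable:
  "card (left_removable N) =
    (\<Sum>k<N. (k + 1) * av_count k * ((N - 1 - k) * av_count (N - 1 - k)))"
proof -
  have "card (left_removable N) = (\<Sum>k<N. \<Sum>v\<in>{k<..<N}.
     card {p \<in> permutations_of_set (insert v {..<k}). av231 (removeAll v p)} *
     card {p \<in> permutations_of_set ({k..<N} - {v}). av231 p})"
  proof (rule card_pairs[where V = "\<lambda>k v. insert v {..<k}" and W = "\<lambda>k v. {k..<N} - {v}"])
    show "k = k' \<and> v = v'" if "v \<in> {k<..<N}" "v' \<in> {k'<..<N}" "insert v {..<k} = insert v' {..<k'}"
      for k k' v v' using that by (intro left_sets_inj) auto
    show "(L, R) \<in> left_removable N \<longleftrightarrow> (\<exists>k v. k < N \<and> v \<in> {k<..<N} \<and>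
      L \<in> {p \<in> permutations_of_set (insert v {..<k}). av231 (removeAll v p)} \<and>
      R \<in> {p \<in> permutations_of_set ({k..<N} - {v}). av231 p})" for L R
      unfolding left_removable_iff by simp (meson less_trans)
  qed auto
  also have "\<dots> = (\<Sum>k<N. (k + 1) * av_count k * ((N - 1 - k) * av_count (N - 1 - k)))"
    by (intro sum.cong refl) (simp add: card_av231_removeAll card_av231)
  finally show ?thesis .
qed

lemma card_right_removable:
  "card (right_removable N) =
    (\<Sum>k<N. (k * av_count k) * ((N - k) * av_count (N - 1 - k)))"
proof -
  have "card (right_removable N) = (\<Sum>k<N. \<Sum>v\<in>{..<k}.
     card {p \<in> permutations_of_set ({..k} - {v}). av231 p} *
     card {p \<in> permutations_of_set (insert v {k<..<N}). av231 (removeAll v p)})"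
  proof (rule card_pairs[where V = "\<lambda>k v. {..k} - {v}" and W = "\<lambda>k v. insert v {k<..<N}"])
    show "k = k' \<and> v = v'" if "v \<in> {..<k}" "v' \<in> {..<k'}" "{..k} - {v} = {..k'} - {v' :: nat}"
      for k k' v v' using that by (intro right_sets_inj) auto
    show "(L, R) \<in> right_removable N \<longleftrightarrow> (\<exists>k v. k < N \<and> v \<in> {..<k} \<and>
      L \<in> {p \<in> permutations_of_set ({..k} - {v}). av231 p} \<and>
      R \<in> {p \<in> permutations_of_set (insert v {k<..<N}). av231 (removeAll v p)})" for L R
      unfolding right_removable_iff by auto
  qed auto
  also have "\<dots> = (\<Sum>k<N. (k * av_count k) * ((N - k) * av_count (N - 1 - k)))"
  proof (intro sum.cong refl)
    fix k assume "k \<in> {..<N}"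
    \<comment> \<open>The number of places to insert \<open>v\<close> among the
      \<open>N - 1 - k\<close> larger entries of \<open>R\<close>.\<close>
    then have "Suc (N - Suc k) = N - k" by auto
    then show "(\<Sum>v\<in>{..<k}. card {p \<in> permutations_of_set ({..k} - {v}). av231 p} *
     card {p \<in> permutations_of_set (insert v {k<..<N}). av231 (removeAll v p)}) =
      (k * av_count k) * ((N - k) * av_count (N - 1 - k))"
      by (simp add: card_av231_removeAll card_av231)
  qed
  finally show ?thesis .
qed

section \<open>Intersections of the crossing cases\<close>

text \<open>Equating the two descriptions of the entries of \<open>L\<close> forces
  \<open>v = k + 1\<close> and \<open>v' = k\<close>: the sides differ from separated ones by
  exchanging two consecutive values.\<close>

lemma left_right_removable_iff:
  "(L, R) \<in> left_removable N \<inter> right_removable N \<longleftrightarrow> (\<exists>k. Suc k < N \<and>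
     L \<in> permutations_of_set (insert (Suc k) {..<k}) \<and> av231 L \<and>
     R \<in> permutations_of_set (insert k {Suc k<..<N}) \<and> av231 R)" (is "?l \<longleftrightarrow> ?r")
proof
  assume ?l
  then obtain k v k' v' where
    l: "k < v" "v < N" "L \<in> permutations_of_set (insert v {..<k})" "av231 R" and
    r: "v' < k'" "k' < N" "L \<in> permutations_of_set ({..k'} - {v'})" "av231 L"
      "R \<in> permutations_of_set (insert v' {k'<..<N})"
    unfolding Int_iff left_removable_iff right_removable_iff by blast
  have eq: "insert v {..<k} = {..k'} - {v'}"
    using l(3) r(3) by (auto simp: permutations_of_set_def)
  have "card (insert v {..<k}) = Suc k" "card ({..k'} - {v'}) = k'" using l(1) r(1) by auto
  then have k': "k' = Suc k" using eq by simp
  have "v \<le> k'" "v' \<notin> {..<k}" using eq by blast+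
  then have "v = Suc k" "v' = k" using l(1) r(1) k' by auto
  then show ?r using l r k' by blast
next
  assume ?r
  then obtain k where k: "Suc k < N" "L \<in> permutations_of_set (insert (Suc k) {..<k})" "av231 L"
    "R \<in> permutations_of_set (insert k {Suc k<..<N})" "av231 R" by blast
  have "insert k {Suc k<..<N} = {k..<N} - {Suc k}" "insert (Suc k) {..<k} = {..Suc k} - {k}"
    using k(1) by auto
  then show ?l unfolding Int_iff left_removable_iff right_removable_iff
    using k av231_removeAll lessI by metis
qed

text \<open>The second index of the common scheme is confined to the singleton
  \<open>{Suc k}\<close>, since \<open>v\<close> is determined by \<open>k\<close>.\<close>

lemma card_left_right_removable:
  "card (left_removable N \<inter> right_removable N) = (\<Sum>k<N - 1. av_count (Suc k) * av_count (N - 1 - k))"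
proof -
  have "card (left_removable N \<inter> right_removable N) = (\<Sum>k<N - 1. \<Sum>v\<in>{Suc k}.
     card {p \<in> permutations_of_set (insert (Suc k) {..<k}). av231 p} *
     card {p \<in> permutations_of_set (insert k {Suc k<..<N}). av231 p})"
  proof (rule card_pairs[where V = "\<lambda>k v. insert (Suc k) {..<k}" and W = "\<lambda>k v. insert k {Suc k<..<N}"])
    show "k = k' \<and> v = v'" if "v \<in> {Suc k}" "v' \<in> {Suc k'}" "insert (Suc k) {..<k} = insert (Suc k') {..<k'}"
      for k k' v v' using left_sets_inj[of k "Suc k" k' "Suc k'"] that by simp
    show "(L, R) \<in> left_removable N \<inter> right_removable N \<longleftrightarrow> (\<exists>k v. k < N - 1 \<and> v \<in> {Suc k} \<and>
      L \<in> {p \<in> permutations_of_set (insert (Suc k) {..<k}). av231 p} \<and>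
      R \<in> {p \<in> permutations_of_set (insert k {Suc k<..<N}). av231 p})" for L R
      unfolding left_right_removable_iff by (auto simp: less_diff_conv)
  qed auto
  also have "\<dots> = (\<Sum>k<N - 1. av_count (Suc k) * av_count (N - 1 - k))"
  proof (intro sum.cong refl)
    fix k assume "k \<in> {..<N - 1}"
    then have "card (insert k {Suc k<..<N}) = N - 1 - k" by auto
    then show "(\<Sum>v\<in>{Suc k}. card {p \<in> permutations_of_set (insert (Suc k) {..<k}). av231 p} *
       card {p \<in> permutations_of_set (insert k {Suc k<..<N}). av231 p}) =
       av_count (Suc k) * av_count (N - 1 - k)" by (simp add: card_av231)
  qed
  finally show ?thesis .
qed

text \<open>Since \<open>v\<close> is the maximum of \<open>L\<close> and the only entry of
  \<open>L\<close> that can exceed entries of \<open>R\<close>, avoidance by \<open>L @ R\<close>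
  decouples into conditions on \<open>L\<close> and on \<open>v # R\<close>.\<close>

lemma top_left_removable_iff:
  "(L, R) \<in> top_removable N \<inter> left_removable N \<longleftrightarrow> (\<exists>k v. k < v \<and> v < N \<and>
     L \<in> permutations_of_set (insert v {..<k}) \<and> av231 L \<and>
     R \<in> permutations_of_set ({k..<N} - {v}) \<and> av231 (v # R))" (is "?l \<longleftrightarrow> ?r")
proof -
  have top: "(L, R) \<in> top_removable N \<longleftrightarrow> av231 (L @ R)" if "(L, R) \<in> left_removable N"
    using that by (auto simp: top_removable_def left_removable_def)
  have iff: "av231 (L @ R) \<longleftrightarrow> av231 L \<and> av231 (v # R)"
    if "k < v" "set L = insert v {..<k}" "set R = {k..<N} - {v}" for k v
    using that by (intro av231_append_max) auto
  show ?thesis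
  proof
    assume ?l
    then have "av231 (L @ R)" using top by blast
    then show ?r using \<open>?l\<close> iff unfolding Int_iff left_removable_iff permutations_of_set_def by blast
  next
    assume ?r
    then obtain k v where kv: "k < v" "v < N" "L \<in> permutations_of_set (insert v {..<k})" "av231 L"
      "R \<in> permutations_of_set ({k..<N} - {v})" "av231 (v # R)" by blast
    then have "av231 R" by (simp add: av231_Cons)
    then have "(L, R) \<in> left_removable N"
      unfolding left_removable_iff using kv av231_removeAll by blast
    moreover have "av231 (L @ R)"
      using iff kv unfolding permutations_of_set_def by blast
    ultimately show ?l using top by blast
  qed
qed

text \<open>An entry above \<open>v\<close> followed by one below \<open>v\<close> would form an
  occurrence starting with \<open>v\<close>.\<close>

lemma av231_Cons_split:
  assumes "v \<notin> set R" "av231 (v # R)"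
  shows "R = filter (\<lambda>x. x < v) R @ filter (\<lambda>x. v < x) R"
  using assms
proof (induction R)
  case (Cons x R)
  then have IH: "R = filter (\<lambda>x. x < v) R @ filter (\<lambda>x. v < x) R"
    by (auto simp: av231_Cons subseq2_Cons simp del: subseq_Cons2_iff)
  show ?case
  proof (cases "x < v")
    case False
    then have "v < x" using Cons.prems by auto
    then have "\<forall>y\<in>set R. \<not> y < v"
      using Cons.prems(2) by (auto simp: av231_Cons subseq2_Cons simp del: subseq_Cons2_iff)
    then have "filter (\<lambda>x. x < v) R = []" by simp
    then show ?thesis using IH \<open>v < x\<close> by simp
  qed (use IH in simp)
qed simp

text \<open>By the splitting of \<open>R\<close> around \<open>v\<close>, the word is an avoiding
  word on \<open>U\<close> followed by one on \<open>W\<close>. Conversely, \<open>v\<close> exceeds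
  all of \<open>U\<close> and stays below all of \<open>W\<close>, so it starts no
  occurrence.\<close>

lemma card_av231_Cons:
  assumes "finite U" "finite W" "\<forall>u\<in>U. u < v" "\<forall>w\<in>W. v < w"
  shows "card {R \<in> permutations_of_set (U \<union> W). av231 (v # R)} = av_count (card U) * av_count (card W)"
proof -
  have sub: "set R1 = U \<Longrightarrow> set R2 = W \<Longrightarrow> av231 (v # R1 @ R2) \<longleftrightarrow> av231 R1 \<and> av231 R2" for R1 R2
  proof -
    assume s: "set R1 = U" "set R2 = W"
    have "av231 (v # R1) \<longleftrightarrow> av231 R1"
      unfolding av231_Cons using s(1) assms(3) by (meson less_asym subseq2_mem)
    moreover have "\<forall>l\<in>set (v # R1). \<forall>r\<in>set R2. l < r"
      using assms(3,4) s by simp (meson less_trans)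
    ultimately show ?thesis using av231_append_less[of "v # R1" R2] by simp
  qed
  have "bij_betw (\<lambda>(R1, R2). R1 @ R2)
     ({p \<in> permutations_of_set U. av231 p} \<times> {p \<in> permutations_of_set W. av231 p})
     {R \<in> permutations_of_set (U \<union> W). av231 (v # R)}"
    unfolding bij_betw_def
  proof
    show "inj_on (\<lambda>(R1, R2). R1 @ R2)
      ({p \<in> permutations_of_set U. av231 p} \<times> {p \<in> permutations_of_set W. av231 p})"
    proof (rule inj_onI, clarify)
      fix a b a' b' assume p: "a \<in> permutations_of_set U" "a' \<in> permutations_of_set U"
        and eq: "a @ b = a' @ b'"
      have "length a = length a'" using p by (metis distinct_card permutations_of_setD)
      then show "a = a' \<and> b = b'" using eq by simp
    qed
    show "(\<lambda>(R1, R2). R1 @ R2) `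
        ({p \<in> permutations_of_set U. av231 p} \<times> {p \<in> permutations_of_set W. av231 p}) =
      {R \<in> permutations_of_set (U \<union> W). av231 (v # R)}" (is "_ ` ?A = ?B")
    proof (intro subset_antisym subsetI)
      fix R assume "R \<in> (\<lambda>(R1, R2). R1 @ R2) ` ?A"
      then obtain R1 R2 where R: "R = R1 @ R2" "set R1 = U" "set R2 = W" "distinct R1" "distinct R2"
        "av231 R1" "av231 R2" by (auto simp: permutations_of_set_def)
      moreover have "U \<inter> W = {}" using assms(3,4) less_asym by blast
      ultimately show "R \<in> ?B" using sub[OF R(2,3)] by (simp add: permutations_of_set_def)
    next
      fix R assume "R \<in> ?B"
      then have R: "set R = U \<union> W" "distinct R" "av231 (v # R)" by (auto simp: permutations_of_set_def)
      define R1 R2 where "R1 = filter (\<lambda>x. x < v) R" and "R2 = filter (\<lambda>x. v < x) R"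
      have "v \<notin> set R" unfolding R(1) using assms(3,4) by auto
      then have "R = R1 @ R2" unfolding R1_def R2_def by (rule av231_Cons_split[OF _ R(3)])
      moreover have s: "set R1 = U" "set R2 = W"
        using assms(3,4) by (auto simp: R1_def R2_def R(1))
      moreover have "distinct R1" "distinct R2" using R(2) by (auto simp: R1_def R2_def)
      ultimately show "R \<in> (\<lambda>(R1, R2). R1 @ R2) ` ?A" using sub[OF s] R(3)
        by (auto simp: permutations_of_set_def intro!: image_eqI[of _ _ "(R1, R2)"])
    qed
  qed
  then have "card {R \<in> permutations_of_set (U \<union> W). av231 (v # R)} =
     card ({p \<in> permutations_of_set U. av231 p} \<times> {p \<in> permutations_of_set W. av231 p})"
    by (simp add: bij_betw_same_card)
  then show ?thesis by (simp add: card_cartesian_product card_av231 assms)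
qed

lemma card_top_left_removable:
  "card (top_removable N \<inter> left_removable N) =
    (\<Sum>k<N. \<Sum>v\<in>{k<..<N}. av_count (Suc k) * (av_count (v - k) * av_count (N - 1 - v)))"
proof -
  have "card (top_removable N \<inter> left_removable N) = (\<Sum>k<N. \<Sum>v\<in>{k<..<N}.
     card {p \<in> permutations_of_set (insert v {..<k}). av231 p} *
     card {p \<in> permutations_of_set ({k..<N} - {v}). av231 (v # p)})"
  proof (rule card_pairs[where V = "\<lambda>k v. insert v {..<k}" and W = "\<lambda>k v. {k..<N} - {v}"])
    show "k = k' \<and> v = v'" if "v \<in> {k<..<N}" "v' \<in> {k'<..<N}" "insert v {..<k} = insert v' {..<k'}"
      for k k' v v' using that by (intro left_sets_inj) auto
    show "(L, R) \<in> top_removable N \<inter> left_removable N \<longleftrightarrow> (\<exists>k v. k < N \<and> v \<in> {k<..<N} \<and>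
      L \<in> {p \<in> permutations_of_set (insert v {..<k}). av231 p} \<and>
      R \<in> {p \<in> permutations_of_set ({k..<N} - {v}). av231 (v # p)})" for L R
      unfolding top_left_removable_iff by simp (meson less_trans)
  qed auto
  also have "\<dots> = (\<Sum>k<N. \<Sum>v\<in>{k<..<N}. av_count (Suc k) * (av_count (v - k) * av_count (N - 1 - v)))"
  proof (intro sum.cong refl)
    fix k v assume v: "v \<in> {k<..<N}"
    \<comment> \<open>There are \<open>v - k\<close> entries of \<open>R\<close> below
      \<open>v\<close> and \<open>N - 1 - v\<close> above it.\<close>
    have "{k..<N} - {v} = {k..<v} \<union> {v<..<N}" using v by auto
    then have "card {p \<in> permutations_of_set ({k..<N} - {v}). av231 (v # p)} =
       av_count (v - k) * av_count (N - 1 - v)"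
      by (simp add: card_av231_Cons)
    then show "card {p \<in> permutations_of_set (insert v {..<k}). av231 p} *
     card {p \<in> permutations_of_set ({k..<N} - {v}). av231 (v # p)} =
       av_count (Suc k) * (av_count (v - k) * av_count (N - 1 - v))"
      using v by (simp add: card_av231)
  qed
  finally show ?thesis .
qed


text \<open>Inclusion-exclusion is taken over the reals so that the subtractions are
  genuine.\<close>

lemma card_Un3:
  assumes "finite A" "finite B" "finite C"
  shows "real (card (A \<union> B \<union> C)) = real (card A) + real (card B) + real (card C)
    - real (card (A \<inter> B)) - real (card (A \<inter> C)) - real (card (B \<inter> C)) + real (card (A \<inter> (B \<inter> C)))"
proof -
  have "card (A \<union> B) + card (A \<inter> B) = card A + card B"
    using card_Un_Int[of A B] assms by simp
  moreover have "card (A \<union> B \<union> C) + card ((A \<inter> C) \<union> (B \<inter> C)) = card (A \<union> B) + card C"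
    using card_Un_Int[of "A \<union> B" C] assms by (simp add: Int_Un_distrib2)
  moreover have "card ((A \<inter> C) \<union> (B \<inter> C)) + card (A \<inter> (B \<inter> C)) = card (A \<inter> C) + card (B \<inter> C)"
    using card_Un_Int[of "A \<inter> C" "B \<inter> C"] assms by (simp add: Int_ac)
  ultimately show ?thesis by linarith
qed

lemma permutations_of_set_Cons:
  assumes "v \<notin> A"
  shows "v # R \<in> permutations_of_set (insert v A) \<longleftrightarrow> R \<in> permutations_of_set A"
  using assms by (auto simp: permutations_of_set_def)

lemma top_removable_iff:
  assumes "(L, R) \<in> left_removable N \<union> right_removable N"
  shows "(L, R) \<in> top_removable N \<longleftrightarrow> av231 (L @ R)"
  using assms by (auto simp: top_removable_def left_removable_def right_removable_def)

text \<open>Avoidance forces \<open>v\<close> to the front of \<open>R\<close>; writing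
  \<open>R\<close> as an image under \<open>(#) v\<close> gives the condition the product form
  required for counting.\<close>

lemma top_right_removable_iff:
  "(L, R) \<in> top_removable N \<inter> right_removable N \<longleftrightarrow> (\<exists>k v. v < k \<and> k < N \<and>
     L \<in> permutations_of_set ({..k} - {v}) \<and> av231 (L @ [v]) \<and>
     R \<in> (#) v ` {p \<in> permutations_of_set {k<..<N}. av231 p})" (is "?l \<longleftrightarrow> ?r")
proof -
  have iff: "av231 (L @ R) \<longleftrightarrow> (\<exists>R'. R = v # R' \<and> av231 (L @ [v]) \<and> av231 R')"
    if "v < k" "L \<in> permutations_of_set ({..k} - {v})" "R \<in> permutations_of_set (insert v {k<..<N})" for k v
    \<comment> \<open>The entry \<open>k\<close> belongs to \<open>L\<close> and exceeds
      \<open>v\<close>.\<close>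
    using that by (intro av231_append_min[where l = k]) (auto simp: permutations_of_set_def)
  show ?thesis
  proof
    assume l: ?l
    then obtain k v where kv: "v < k" "k < N" "L \<in> permutations_of_set ({..k} - {v})"
      "R \<in> permutations_of_set (insert v {k<..<N})"
      unfolding Int_iff right_removable_iff by blast
    moreover have "av231 (L @ R)" using l top_removable_iff by blast
    ultimately obtain R' where R': "R = v # R'" "av231 (L @ [v])" "av231 R'" using iff by blast
    have "v \<notin> {k<..<N}" using kv(1) by simp
    then have "R' \<in> permutations_of_set {k<..<N}"
      using kv(4) R'(1) permutations_of_set_Cons[of v "{k<..<N}" R'] by simp
    then show ?r using kv R' by blast
  next
    assume ?r
    then obtain k v R' where kv: "v < k" "k < N" "L \<in> permutations_of_set ({..k} - {v})"
      "av231 (L @ [v])" "R = v # R'" "R' \<in> permutations_of_set {k<..<N}" "av231 R'" by blast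
    have v: "v \<notin> {k<..<N}" using kv(1) by simp
    then have R: "R \<in> permutations_of_set (insert v {k<..<N})"
      using kv(5,6) permutations_of_set_Cons[of v "{k<..<N}" R'] by simp
    have "v \<notin> set R'" using v permutations_of_setD(1)[OF kv(6)] by simp
    then have "removeAll v R = R'" using kv(5) by (simp add: removeAll_id)
    moreover have "av231 L" using kv(4) by (simp add: av231_append)
    ultimately have "(L, R) \<in> right_removable N"
      unfolding right_removable_iff using kv R by blast
    moreover have "av231 (L @ R)" using iff[OF kv(1,3) R] kv by blast
    ultimately show ?l using top_removable_iff by blast
  qed
qed

lemma top_left_right_removable_iff:
  "(L, R) \<in> top_removable N \<inter> (left_removable N \<inter> right_removable N) \<longleftrightarrow> (\<exists>k. Suc k < N \<and>
     L \<in> permutations_of_set (insert (Suc k) {..<k}) \<and> av231 L \<and>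
     R \<in> (#) k ` {p \<in> permutations_of_set {Suc k<..<N}. av231 p})" (is "?l \<longleftrightarrow> ?r")
proof -
  have iff: "av231 (L @ R) \<longleftrightarrow> (\<exists>R'. R = k # R' \<and> av231 (L @ [k]) \<and> av231 R')"
    if "L \<in> permutations_of_set (insert (Suc k) {..<k})" "R \<in> permutations_of_set (insert k {Suc k<..<N})" for k
    using that by (intro av231_append_min[where l = "Suc k"]) (auto simp: permutations_of_set_def)
  have pair: "av231 [Suc k, k]" for k
    by (auto simp: av231_Cons subseq2_Cons av231_def simp del: subseq_Cons2_iff)
  \<comment> \<open>Only the maximum \<open>Suc k\<close> of \<open>L\<close> exceeds
    \<open>k\<close>, so appending \<open>k\<close> reduces to the harmless two-letter word
    \<open>[Suc k, k]\<close>.\<close>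
  have snoc: "av231 (L @ [k])" if "L \<in> permutations_of_set (insert (Suc k) {..<k})" "av231 L" for k
    using that pair[of k] by (subst av231_append_max[of "Suc k"]) (auto simp: permutations_of_set_def)
  show ?thesis
  proof
    assume l: ?l
    then obtain k where k: "Suc k < N" "L \<in> permutations_of_set (insert (Suc k) {..<k})" "av231 L"
      "R \<in> permutations_of_set (insert k {Suc k<..<N})"
      using left_right_removable_iff by blast
    moreover have "av231 (L @ R)" using l top_removable_iff by blast
    ultimately obtain R' where R': "R = k # R'" "av231 R'" using iff by blast
    have "R' \<in> permutations_of_set {Suc k<..<N}"
      using k(4) R'(1) permutations_of_set_Cons[of k "{Suc k<..<N}" R'] by simp
    then show ?r using k R' by blast
  next
    assume ?r
    then obtain k R' where k: "Suc k < N" "L \<in> permutations_of_set (insert (Suc k) {..<k})"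
      "av231 L" "R = k # R'" "R' \<in> permutations_of_set {Suc k<..<N}" "av231 R'" by blast
    have R: "R \<in> permutations_of_set (insert k {Suc k<..<N})"
      using k(4,5) permutations_of_set_Cons[of k "{Suc k<..<N}" R'] by simp
    have av: "av231 (L @ R)" using iff[OF k(2) R] snoc[OF k(2,3)] k by blast
    then have "av231 R" by (simp add: av231_append)
    then have "(L, R) \<in> left_removable N \<inter> right_removable N"
      unfolding left_right_removable_iff using k R by blast
    then show ?l using top_removable_iff av by blast
  qed
qed

lemma card_Cons_image:
  "finite V \<Longrightarrow> card ((#) v ` {p \<in> permutations_of_set V. av231 p}) = av_count (card V)"
  by (subst card_image) (auto simp: card_av231)

text \<open>Avoiding permutations of \<open>{..k}\<close> are classified by their last entry
  \<open>v\<close>.\<close>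

lemma sum_card_snoc:
  "(\<Sum>v\<le>k. card {L \<in> permutations_of_set ({..k} - {v}). av231 (L @ [v])}) = av_count (Suc k)"
proof -
  define F where "F v = (\<lambda>L. L @ [v]) ` {L \<in> permutations_of_set ({..k} - {v}). av231 (L @ [v])}" for v
  have "{p \<in> permutations_of_set {..k}. av231 p} = (\<Union>v\<in>{..k}. F v)"
  proof (intro subset_antisym subsetI)
    fix p assume p: "p \<in> {p \<in> permutations_of_set {..k}. av231 p}"
    then have "p \<noteq> []" by (auto simp: permutations_of_set_def)
    then obtain L v where Lv: "p = L @ [v]" by (cases p rule: rev_cases) auto
    have "set p = {..k}" "distinct p" using p by (simp_all add: permutations_of_set_def)
    then have "insert v (set L) = {..k}" "v \<notin> set L" "distinct L" using Lv by auto
    then have "L \<in> permutations_of_set ({..k} - {v})" "v \<in> {..k}"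
      unfolding permutations_of_set_def by blast+
    moreover have "av231 (L @ [v])" using p Lv by simp
    ultimately show "p \<in> (\<Union>v\<in>{..k}. F v)" unfolding F_def Lv by blast
  next
    fix p assume "p \<in> (\<Union>v\<in>{..k}. F v)"
    then obtain v L where "v \<le> k" "p = L @ [v]" "L \<in> permutations_of_set ({..k} - {v})"
      "av231 (L @ [v])" unfolding F_def by blast
    then show "p \<in> {p \<in> permutations_of_set {..k}. av231 p}"
      by (simp add: permutations_of_set_def insert_absorb)
  qed
  moreover have "card (\<Union>v\<in>{..k}. F v) = (\<Sum>v\<le>k. card (F v))"
    by (rule card_UN_disjoint) (auto simp: F_def)
  moreover have "card (F v) = card {L \<in> permutations_of_set ({..k} - {v}). av231 (L @ [v])}" for v
    unfolding F_def by (rule card_image) (simp add: inj_on_def)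
  ultimately show ?thesis by (simp add: av_count_def lessThan_Suc_atMost)
qed

text \<open>The term \<open>v = k\<close> is split off: a maximum in last position takes part in no
  occurrence.\<close>

lemma sum_card_snoc_less:
  "(\<Sum>v<k. card {L \<in> permutations_of_set ({..k} - {v}). av231 (L @ [v])}) + av_count k = av_count (Suc k)"
proof -
  have "av231 (L @ [k]) \<longleftrightarrow> av231 L" if "L \<in> permutations_of_set {..<k}" for L
    using av231_top[of L "[]" k] that by (auto simp: permutations_of_set_def av231_def)
  moreover have "{..k} - {k} = {..<k}" by auto
  ultimately have "card {L \<in> permutations_of_set ({..k} - {k}). av231 (L @ [k])} = av_count k"
    by (simp add: av_count_def cong: conj_cong)
  then show ?thesis using sum_card_snoc[of k] by (simp add: lessThan_Suc_atMost[symmetric])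
qed

lemma card_top_right_removable:
  "card (top_removable N \<inter> right_removable N) =
    (\<Sum>k<N. (av_count (Suc k) - av_count k) * av_count (N - 1 - k))"
proof -
  have "card (top_removable N \<inter> right_removable N) = (\<Sum>k<N. \<Sum>v\<in>{..<k}.
     card {p \<in> permutations_of_set ({..k} - {v}). av231 (p @ [v])} *
     card ((#) v ` {p \<in> permutations_of_set {k<..<N}. av231 p}))"
  proof (rule card_pairs[where V = "\<lambda>k v. {..k} - {v}" and W = "\<lambda>k v. insert v {k<..<N}"])
    show "k = k' \<and> v = v'" if "v \<in> {..<k}" "v' \<in> {..<k'}" "{..k} - {v} = {..k'} - {v' :: nat}"
      for k k' v v' using that by (intro right_sets_inj) auto
    show "(L, R) \<in> top_removable N \<inter> right_removable N \<longleftrightarrow> (\<exists>k v. k < N \<and> v \<in> {..<k} \<and>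
      L \<in> {p \<in> permutations_of_set ({..k} - {v}). av231 (p @ [v])} \<and>
      R \<in> (#) v ` {p \<in> permutations_of_set {k<..<N}. av231 p})" for L R
      unfolding top_right_removable_iff by auto
    show "(#) v ` {p \<in> permutations_of_set {k<..<N}. av231 p} \<subseteq> permutations_of_set (insert v {k<..<N})"
      if "v \<in> {..<k}" for k v
      using that permutations_of_set_Cons[of v "{k<..<N}"] by auto
  qed auto
  also have "\<dots> = (\<Sum>k<N. (av_count (Suc k) - av_count k) * av_count (N - 1 - k))"
  proof (intro sum.cong refl)
    fix k
    \<comment> \<open>The factor for \<open>R\<close> does not depend on \<open>v\<close>, so the
      sum over \<open>v\<close> can be evaluated on the left factor alone.\<close>
    have "(\<Sum>v<k. card {L \<in> permutations_of_set ({..k} - {v}). av231 (L @ [v])}) =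
        av_count (Suc k) - av_count k"
      using sum_card_snoc_less[of k] by simp
    then show "(\<Sum>v\<in>{..<k}. card {p \<in> permutations_of_set ({..k} - {v}). av231 (p @ [v])} *
      card ((#) v ` {p \<in> permutations_of_set {k<..<N}. av231 p})) =
      (av_count (Suc k) - av_count k) * av_count (N - 1 - k)"
      by (simp add: card_Cons_image flip: sum_distrib_right)
  qed
  finally show ?thesis .
qed

lemma card_top_left_right_removable:
  "card (top_removable N \<inter> (left_removable N \<inter> right_removable N)) =
    (\<Sum>k<N - 1. av_count (Suc k) * av_count (N - 2 - k))"
proof -
  have "card (top_removable N \<inter> (left_removable N \<inter> right_removable N)) = (\<Sum>k<N - 1. \<Sum>v\<in>{Suc k}.
     card {p \<in> permutations_of_set (insert (Suc k) {..<k}). av231 p} *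
     card ((#) k ` {p \<in> permutations_of_set {Suc k<..<N}. av231 p}))"
  proof (rule card_pairs[where V = "\<lambda>k v. insert (Suc k) {..<k}" and W = "\<lambda>k v. insert k {Suc k<..<N}"])
    show "k = k' \<and> v = v'" if "v \<in> {Suc k}" "v' \<in> {Suc k'}" "insert (Suc k) {..<k} = insert (Suc k') {..<k'}"
      for k k' v v' using left_sets_inj[of k "Suc k" k' "Suc k'"] that by simp
    show "(L, R) \<in> top_removable N \<inter> (left_removable N \<inter> right_removable N) \<longleftrightarrow>
      (\<exists>k v. k < N - 1 \<and> v \<in> {Suc k} \<and>
      L \<in> {p \<in> permutations_of_set (insert (Suc k) {..<k}). av231 p} \<and>
      R \<in> (#) k ` {p \<in> permutations_of_set {Suc k<..<N}. av231 p})" for L R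
      unfolding top_left_right_removable_iff by (auto simp: less_diff_conv)
    show "(#) k ` {p \<in> permutations_of_set {Suc k<..<N}. av231 p} \<subseteq> permutations_of_set (insert k {Suc k<..<N})"
      for k using permutations_of_set_Cons[of k "{Suc k<..<N}"] by auto
  qed auto
  also have "\<dots> = (\<Sum>k<N - 1. av_count (Suc k) * av_count (N - 2 - k))"
    by (intro sum.cong refl) (simp add: card_av231 card_Cons_image)
  finally show ?thesis .
qed

section \<open>Recurrence for the almost avoiding permutations\<close>

lemma finite_splits: "finite {(L, R). L @ R \<in> permutations_of_set V \<and> P L R}"
proof -
  have "{(L, R). L @ R \<in> permutations_of_set V \<and> P L R} \<subseteq>
     (\<Union>p\<in>permutations_of_set V. (\<lambda>i. (take i p, drop i p)) ` {..length p})"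
  proof
    fix z assume "z \<in> {(L, R). L @ R \<in> permutations_of_set V \<and> P L R}"
    then obtain L R where z: "z = (L, R)" "L @ R \<in> permutations_of_set V" by auto
    have "z = (\<lambda>i. (take i (L @ R), drop i (L @ R))) (length L)" "length L \<in> {..length (L @ R)}"
      using z(1) by simp_all
    then have "z \<in> (\<lambda>i. (take i (L @ R), drop i (L @ R))) ` {..length (L @ R)}" by (rule image_eqI)
    then show "z \<in> (\<Union>p\<in>permutations_of_set V. (\<lambda>i. (take i p, drop i p)) ` {..length p})"
      using z(2) by blast
  qed
  then show ?thesis by (rule finite_subset) auto
qed

text \<open>All \<open>N + 1\<close> cuts of each avoiding permutation are counted; the separated
  cuts are exactly the separated pairs of avoiding words.\<close>

lemma card_top_removable:
  "card (top_removable N) + (\<Sum>k\<le>N. av_count k * av_count (N - k)) = (N + 1) * av_count N"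
proof -
  define S where "S = {(L, R). L @ R \<in> permutations_of_set {..<N} \<and>
      (\<forall>l\<in>set L. \<forall>r\<in>set R. l < r) \<and> av231 L \<and> av231 R}"
  have "card S = (\<Sum>k\<le>N. av_count k * av_count (N - k))"
    unfolding S_def by (rule card_separated) (simp_all add: card_av231)
  moreover have "{(L, R). L @ R \<in> permutations_of_set {..<N} \<and> av231 (L @ R)} = top_removable N \<union> S"
    unfolding S_def top_removable_def separated_def using av231_append_less by blast
  moreover have "card {(L, R). L @ R \<in> permutations_of_set {..<N} \<and> av231 (L @ R)} = (N + 1) * av_count N"
    using card_splits[of "{..<N}" av231] by (simp add: av_count_def)
  moreover have "top_removable N \<inter> S = {}" by (auto simp: S_def top_removable_def separated_def)
  moreover have "finite S" "finite (top_removable N)"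
    unfolding S_def top_removable_def by (rule finite_splits)+
  ultimately show ?thesis by (simp add: card_Un_disjoint)
qed

text \<open>Separated pairs contribute two equal convolutions minus their overlap, in which both
  sides avoid 231. Crossing pairs contribute the union of the three removable cases.\<close>

lemma almost_count_Suc:
  "real (almost_count (Suc N)) = 2 * (\<Sum>k\<le>N. real (almost_count k) * real (av_count (N - k)))
     - (\<Sum>k\<le>N. real (av_count k) * real (av_count (N - k)))
     + real (card (top_removable N \<union> left_removable N \<union> right_removable N))"
proof -
  define X where "X P Q = {(L, R). L @ R \<in> permutations_of_set {..<N} \<and>
      (\<forall>l\<in>set L. \<forall>r\<in>set R. l < r) \<and> P L \<and> Q R}" for P Q
  define B where "B = top_removable N \<union> left_removable N \<union> right_removable N"
  have fX: "finite (X P Q)" for P Q unfolding X_def by (rule finite_splits)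
  have fB: "finite B" unfolding B_def top_removable_def left_removable_def right_removable_def
    by (intro finite_UnI finite_splits)
  have B: "(L, R) \<in> B \<Longrightarrow> L @ R \<in> permutations_of_set {..<N} \<and> \<not> separated L R" for L R
    by (auto simp: B_def top_removable_def left_removable_def right_removable_def)
  have "almost_count (Suc N) = card {p \<in> permutations_of_set (insert N {..<N}). almost_av231 p}"
    by (simp add: almost_count_def lessThan_Suc)
  also have "\<dots> = card {(L, R). L @ R \<in> permutations_of_set {..<N} \<and> almost_av231 (L @ N # R)}"
    by (rule card_insert_splits) simp
  also have "{(L, R). L @ R \<in> permutations_of_set {..<N} \<and> almost_av231 (L @ N # R)} =
     (X almost_av231 av231 \<union> X av231 almost_av231) \<union> B"
  proof -
    have "(L @ R \<in> permutations_of_set {..<N} \<and> almost_av231 (L @ N # R)) \<longleftrightarrow>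
       (L, R) \<in> (X almost_av231 av231 \<union> X av231 almost_av231) \<union> B" for L R
    proof (cases "L @ R \<in> permutations_of_set {..<N}")
      case p: True
      show ?thesis
      proof (cases "separated L R")
        case True
        then have "(L, R) \<notin> B" using B by blast
        then show ?thesis using almost_av231_top_separated[OF p True] p True
          by (auto simp: X_def separated_def)
      next
        case False
        then show ?thesis using almost_av231_top_crossing[OF p False] p
          unfolding B_def[symmetric] by (auto simp: X_def separated_def)
      qed
    qed (use B in \<open>auto simp: X_def\<close>)
    then show ?thesis by (simp only: set_eq_iff split_paired_All mem_Collect_eq case_prod_conv simp_thms)
  qed
  also have "card \<dots> = card (X almost_av231 av231 \<union> X av231 almost_av231) + card B"
  proof (rule card_Un_disjoint)
    show "(X almost_av231 av231 \<union> X av231 almost_av231) \<inter> B = {}"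
      using B by (auto simp: X_def separated_def)
  qed (use fX fB in auto)
  finally have 1: "almost_count (Suc N) = card (X almost_av231 av231 \<union> X av231 almost_av231) + card B" .
  have "X almost_av231 av231 \<inter> X av231 almost_av231 = X av231 av231"
    using av231_imp_almost by (auto simp: X_def)
  then have 2: "card (X almost_av231 av231 \<union> X av231 almost_av231) + card (X av231 av231) =
      card (X almost_av231 av231) + card (X av231 almost_av231)"
    using card_Un_Int[OF fX fX, of almost_av231 av231 av231 almost_av231] by simp
  have 3: "card (X almost_av231 av231) = (\<Sum>k\<le>N. almost_count k * av_count (N - k))"
    "card (X av231 almost_av231) = (\<Sum>k\<le>N. av_count k * almost_count (N - k))"
    "card (X av231 av231) = (\<Sum>k\<le>N. av_count k * av_count (N - k))"
    unfolding X_def by (rule card_separated; simp add: card_av231 card_almost_av231)+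
  have "(\<Sum>k\<le>N. av_count k * almost_count (N - k)) = (\<Sum>k\<le>N. almost_count k * av_count (N - k))"
    by (rule sum.reindex_bij_witness[of _ "\<lambda>k. N - k" "\<lambda>k. N - k"]) auto
  then have "almost_count (Suc N) + (\<Sum>k\<le>N. av_count k * av_count (N - k)) =
      2 * (\<Sum>k\<le>N. almost_count k * av_count (N - k)) + card B"
    using 1 2 3 by simp
  then have "real (almost_count (Suc N) + (\<Sum>k\<le>N. av_count k * av_count (N - k))) =
      real (2 * (\<Sum>k\<le>N. almost_count k * av_count (N - k)) + card B)" by simp
  then show ?thesis unfolding B_def by simp
qed


section \<open>Generating functions\<close>

definition av_gf :: "real fps" where
  "av_gf = Abs_fps (\<lambda>n. real (av_count n))"

definition almost_gf :: "real fps" where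
  "almost_gf = Abs_fps (\<lambda>n. real (almost_count n))"

lemma fps_shift_av_gf: "fps_shift 1 av_gf = av_gf * av_gf"
  by (rule fps_ext) (simp add: av_gf_def fps_mult_nth av_count_Suc atLeast0AtMost)

lemma av_gf_eq: "av_gf = 1 + fps_X * (av_gf * av_gf)"
proof (rule fps_ext)
  fix n show "av_gf $ n = (1 + fps_X * (av_gf * av_gf)) $ n"
    unfolding fps_shift_av_gf[symmetric] by (cases n) (simp_all add: av_gf_def av_count_0)
qed

lemma nth_square_av_gf: "(av_gf * av_gf) $ n = real (av_count (Suc n))"
  unfolding fps_shift_av_gf[symmetric] by (simp add: av_gf_def)

lemma nth_deriv_av_gf: "(fps_X * fps_deriv av_gf) $ n = real (n * av_count n)"
  by (cases n) (simp_all add: av_gf_def algebra_simps)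

lemma nth_Suc_fps_X_mult: "(fps_X * f) $ Suc n = (f :: 'a :: comm_ring_1 fps) $ n"
  by simp

text \<open>The factor \<open>n + 1\<close> counts insertion places, so insertion into an avoiding
  word is encoded by the derivative of \<open>x C\<close>.\<close>

lemma nth_deriv_X_av_gf: "fps_deriv (fps_X * av_gf) $ n = real ((n + 1) * av_count n)"
  by (simp add: av_gf_def)

lemma gf_top_removable:
  "Abs_fps (\<lambda>N. real (card (top_removable N))) = fps_deriv (fps_X * av_gf) - av_gf * av_gf"
proof (rule fps_ext)
  fix N
  have "real (card (top_removable N)) + real (av_count (Suc N)) = real ((N + 1) * av_count N)"
    unfolding av_count_Suc card_top_removable[of N, symmetric] by simp
  then show "Abs_fps (\<lambda>N. real (card (top_removable N))) $ N =
      (fps_deriv (fps_X * av_gf) - av_gf * av_gf) $ N"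
    unfolding fps_sub_nth nth_deriv_X_av_gf nth_square_av_gf by simp
qed

lemma gf_left_removable:
  "Abs_fps (\<lambda>N. real (card (left_removable N))) =
    fps_X * (fps_deriv (fps_X * av_gf) * (fps_X * fps_deriv av_gf))"
proof (rule fps_ext)
  fix N show "Abs_fps (\<lambda>N. real (card (left_removable N))) $ N =
      (fps_X * (fps_deriv (fps_X * av_gf) * (fps_X * fps_deriv av_gf))) $ N"
  proof (cases N)
    case (Suc M)
    have "real (card (left_removable N)) =
        (\<Sum>k=0..M. real ((k + 1) * av_count k) * real ((M - k) * av_count (M - k)))"
      unfolding card_left_removable Suc lessThan_Suc_atMost atLeast0AtMost by simp
    then show ?thesis
      unfolding Suc nth_Suc_fps_X_mult fps_mult_nth[of "fps_deriv _"] nth_deriv_X_av_gf nth_deriv_av_gf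
        fps_nth_Abs_fps .
  qed (simp add: card_left_removable)
qed

lemma gf_right_removable:
  "Abs_fps (\<lambda>N. real (card (right_removable N))) =
    fps_X * ((fps_X * fps_deriv av_gf) * fps_deriv (fps_X * av_gf))"
proof (rule fps_ext)
  fix N show "Abs_fps (\<lambda>N. real (card (right_removable N))) $ N =
      (fps_X * ((fps_X * fps_deriv av_gf) * fps_deriv (fps_X * av_gf))) $ N"
  proof (cases N)
    case (Suc M)
    have "real (card (right_removable N)) =
        (\<Sum>k=0..M. real (k * av_count k) * real ((M - k + 1) * av_count (M - k)))"
      unfolding card_right_removable Suc lessThan_Suc_atMost atLeast0AtMost
      by (simp add: Suc_diff_le)
    then show ?thesis
      unfolding Suc nth_Suc_fps_X_mult fps_mult_nth[of "_ * fps_deriv _"] nth_deriv_X_av_gf nth_deriv_av_gf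
        fps_nth_Abs_fps .
  qed (simp add: card_right_removable)
qed

text \<open>Both Catalan indices are shifted by one, so each factor is \<open>C^2\<close>; the range
  of the sum accounts for \<open>x^2\<close>.\<close>

lemma gf_left_right_removable:
  "Abs_fps (\<lambda>N. real (card (left_removable N \<inter> right_removable N))) =
    fps_X * (fps_X * ((av_gf * av_gf) * (av_gf * av_gf)))"
proof (rule fps_ext)
  fix N show "Abs_fps (\<lambda>N. real (card (left_removable N \<inter> right_removable N))) $ N =
      (fps_X * (fps_X * ((av_gf * av_gf) * (av_gf * av_gf)))) $ N"
  proof (cases "N < 2")
    case False
    then obtain M where N: "N = Suc (Suc M)" by (metis add_2_eq_Suc le_iff_add not_less)
    have "real (card (left_removable N \<inter> right_removable N)) =
        (\<Sum>k=0..M. real (av_count (Suc k)) * real (av_count (Suc (M - k))))"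
      unfolding card_left_right_removable N by (simp add: lessThan_Suc_atMost atLeast0AtMost Suc_diff_le)
    then show ?thesis
      unfolding fps_X_mult_nth fps_mult_nth[of "av_gf * av_gf"] nth_square_av_gf using N by simp
  qed (auto simp: card_left_right_removable less_2_cases_iff)
qed

lemma gf_top_left_right_removable:
  "Abs_fps (\<lambda>N. real (card (top_removable N \<inter> (left_removable N \<inter> right_removable N)))) =
    fps_X * (fps_X * ((av_gf * av_gf) * av_gf))"
proof (rule fps_ext)
  fix N show "Abs_fps (\<lambda>N. real (card (top_removable N \<inter> (left_removable N \<inter> right_removable N)))) $ N =
      (fps_X * (fps_X * ((av_gf * av_gf) * av_gf))) $ N"
  proof (cases "N < 2")
    case False
    then obtain M where N: "N = Suc (Suc M)" by (metis add_2_eq_Suc le_iff_add not_less)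
    have "real (card (top_removable N \<inter> (left_removable N \<inter> right_removable N))) =
        (\<Sum>k=0..M. real (av_count (Suc k)) * real (av_count (M - k)))"
      unfolding card_top_left_right_removable N by (simp add: lessThan_Suc_atMost atLeast0AtMost)
    then show ?thesis
      unfolding fps_X_mult_nth fps_mult_nth[of "av_gf * av_gf"] nth_square_av_gf using N
      by (simp add: av_gf_def)
  qed (auto simp: card_top_left_right_removable less_2_cases_iff)
qed

lemma gf_top_right_removable:
  "Abs_fps (\<lambda>N. real (card (top_removable N \<inter> right_removable N))) =
    fps_X * ((av_gf * av_gf - av_gf) * av_gf)"
proof (rule fps_ext)
  fix N show "Abs_fps (\<lambda>N. real (card (top_removable N \<inter> right_removable N))) $ N =
      (fps_X * ((av_gf * av_gf - av_gf) * av_gf)) $ N"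
  proof (cases N)
    case (Suc M)
    \<comment> \<open>Monotonicity turns the truncated difference of naturals into a real
      difference.\<close>
    have "av_count k \<le> av_count (Suc k)" for k using sum_card_snoc_less[of k] by linarith
    then have "real (card (top_removable N \<inter> right_removable N)) =
        (\<Sum>k=0..M. (real (av_count (Suc k)) - real (av_count k)) * real (av_count (M - k)))"
      unfolding card_top_right_removable Suc
      by (simp add: lessThan_Suc_atMost atLeast0AtMost of_nat_diff)
    then show ?thesis
      unfolding fps_X_mult_nth fps_mult_nth[of "_ - av_gf"] fps_sub_nth nth_square_av_gf using Suc
      by (simp add: av_gf_def)
  qed (simp add: card_top_right_removable)
qed

lemma gf_top_left_removable:
  "Abs_fps (\<lambda>N. real (card (top_removable N \<inter> left_removable N))) =
    fps_X * (fps_X * ((av_gf * av_gf) * ((av_gf * av_gf) * av_gf)))"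
proof (rule fps_ext)
  fix N show "Abs_fps (\<lambda>N. real (card (top_removable N \<inter> left_removable N))) $ N =
      (fps_X * (fps_X * ((av_gf * av_gf) * ((av_gf * av_gf) * av_gf)))) $ N"
  proof (cases "N < 2")
    case False
    then obtain M where N: "N = Suc (Suc M)" by (metis add_2_eq_Suc le_iff_add not_less)
    \<comment> \<open>With \<open>v = k + 1 + j\<close> the inner sum is a convolution, giving
      \<open>C^2 * C\<close>.\<close>
    have inner: "(\<Sum>v\<in>{k<..<N}. av_count (Suc k) * (av_count (v - k) * av_count (N - 1 - v))) =
        av_count (Suc k) * (\<Sum>j\<le>M - k. av_count (Suc j) * av_count (M - k - j))" if "k \<le> M" for k
      unfolding sum_distrib_left
      by (rule sum.reindex_bij_witness[of _ "\<lambda>j. k + 1 + j" "\<lambda>v. v - k - 1"])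
         (use N that in \<open>auto simp: Suc_diff_Suc\<close>)
    \<comment> \<open>The outer sum stops at \<open>M = N - 2\<close>, because for
      \<open>k = N - 1\<close> no \<open>v\<close> lies strictly between \<open>k\<close> and
      \<open>N\<close>.\<close>
    have "card (top_removable N \<inter> left_removable N) =
        (\<Sum>k\<le>M. \<Sum>v\<in>{k<..<N}. av_count (Suc k) * (av_count (v - k) * av_count (N - 1 - v)))"
      unfolding card_top_left_removable N by (simp add: lessThan_Suc_atMost)
    also have "\<dots> = (\<Sum>k\<le>M. av_count (Suc k) * (\<Sum>j\<le>M - k. av_count (Suc j) * av_count (M - k - j)))"
      by (intro sum.cong refl inner) simp
    finally have "real (card (top_removable N \<inter> left_removable N)) = (\<Sum>k=0..M. real (av_count (Suc k)) *
        (\<Sum>j=0..M - k. real (av_count (Suc j)) * real (av_count (M - k - j))))"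
      by (simp add: atLeast0AtMost)
    then show ?thesis
      unfolding fps_X_mult_nth fps_mult_nth[of "av_gf * av_gf"] nth_square_av_gf using N
      by (simp add: av_gf_def)
  qed (auto simp: card_top_left_removable less_2_cases_iff)
qed

lemma finite_removable:
  "finite (top_removable N)" "finite (left_removable N)" "finite (right_removable N)"
  unfolding top_removable_def left_removable_def right_removable_def by (rule finite_splits)+

lemma gf_removable:
  "Abs_fps (\<lambda>N. real (card (top_removable N \<union> left_removable N \<union> right_removable N))) =
    (fps_deriv (fps_X * av_gf) - av_gf * av_gf)
    + fps_X * (fps_deriv (fps_X * av_gf) * (fps_X * fps_deriv av_gf))
    + fps_X * ((fps_X * fps_deriv av_gf) * fps_deriv (fps_X * av_gf))
    - fps_X * (fps_X * ((av_gf * av_gf) * ((av_gf * av_gf) * av_gf)))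
    - fps_X * ((av_gf * av_gf - av_gf) * av_gf)
    - fps_X * (fps_X * ((av_gf * av_gf) * (av_gf * av_gf)))
    + fps_X * (fps_X * ((av_gf * av_gf) * av_gf))"
  unfolding gf_top_removable[symmetric] gf_left_removable[symmetric] gf_right_removable[symmetric]
    gf_top_left_removable[symmetric] gf_top_right_removable[symmetric]
    gf_left_right_removable[symmetric] gf_top_left_right_removable[symmetric]
  by (rule fps_ext) (simp add: card_Un3 finite_removable)

lemma almost_gf_eq:
  "almost_gf = 1 + fps_X * (2 * (almost_gf * av_gf) - av_gf * av_gf +
    Abs_fps (\<lambda>N. real (card (top_removable N \<union> left_removable N \<union> right_removable N))))"
proof (rule fps_ext)
  fix n show "almost_gf $ n = (1 + fps_X * (2 * (almost_gf * av_gf) - av_gf * av_gf +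
    Abs_fps (\<lambda>N. real (card (top_removable N \<union> left_removable N \<union> right_removable N))))) $ n"
  proof (cases n)
    case 0
    have "{p \<in> permutations_of_set {..<0}. almost_av231 p} = {[]}"
      by (auto simp: almost_av231_def av231_def)
    then show ?thesis using 0 by (simp add: almost_gf_def almost_count_def)
  next
    case (Suc N)
    have "(2 * (almost_gf * av_gf)) $ N = 2 * (\<Sum>k\<le>N. real (almost_count k) * real (av_count (N - k)))"
      unfolding mult_2 fps_add_nth by (simp add: almost_gf_def av_gf_def fps_mult_nth atLeast0AtMost)
    moreover have "(av_gf * av_gf) $ N = (\<Sum>k\<le>N. real (av_count k) * real (av_count (N - k)))"
      by (simp add: av_gf_def fps_mult_nth atLeast0AtMost)
    ultimately show ?thesis
      using Suc almost_count_Suc[of N] by (simp add: almost_gf_def)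
  qed
qed

section \<open>The square root of 1 - 4x and the closed form\<close>

text \<open>With \<open>Y = x C\<close> the Catalan equation reads \<open>Y - Y^2 = x\<close>, and
  \<open>(1 - 2 Y)^2 = 1 - 4 (Y - Y^2)\<close>.\<close>

lemma sqrt_av_gf: "(1 - 2 * (fps_X * av_gf)) ^ 2 = 1 - 4 * fps_X"
  using av_gf_eq by algebra

text \<open>Differentiating \<open>s^2 = 1 - 4 x\<close> for \<open>s = 1 - 2 x C\<close> gives this
  after division by \<open>-4\<close>; thus the derivative of \<open>x C\<close> is the inverse of
  \<open>s\<close>.\<close>

lemma sqrt_deriv_av_gf: "(1 - 2 * (fps_X * av_gf)) * fps_deriv (fps_X * av_gf) = 1"
proof -
  let ?s = "1 - 2 * (fps_X * av_gf)"
  have const: "fps_deriv (numeral k * f) = numeral k * fps_deriv f" for k and f :: "real fps"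
    by (simp add: numeral_fps_const)
  have "fps_deriv (?s * ?s) = fps_deriv (1 - 4 * fps_X)"
    using sqrt_av_gf by (simp only: power2_eq_square)
  then have "4 * (?s * fps_deriv (fps_X * av_gf)) = 4"
    unfolding fps_deriv_mult[of ?s] fps_deriv_sub const by (simp add: algebra_simps)
  then have "(4 :: real fps) * (?s * fps_deriv (fps_X * av_gf)) = 4 * 1" by simp
  then show ?thesis by (subst (asm) mult_cancel_left) simp
qed

text \<open>Both sides square to \<open>(1 - 4 x)^3\<close>, and the constant term 1 fixes the
  sign.\<close>

lemma one_minus_4x_pow_three_halves_eq:
  "one_minus_4x_pow_three_halves = (1 - 2 * (fps_X * av_gf)) ^ 3"
proof -
  let ?b = one_minus_4x_pow_three_halves and ?s = "1 - 2 * (fps_X * av_gf)"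
  have z: "(- 4 * fps_X :: real fps) $ 0 = 0" by simp
  have "?b ^ 2 = (fps_binomial (3/2) ^ 2) oo (- 4 * fps_X)"
    unfolding one_minus_4x_pow_three_halves_def by (rule fps_compose_power[OF z])
  also have "fps_binomial (3/2 :: real) ^ 2 = (1 + fps_X) ^ 3"
    using fps_binomial_of_nat[of 3, where 'a = real] by (simp add: fps_binomial_power)
  also have "(1 + fps_X) ^ 3 oo (- 4 * fps_X :: real fps) = (1 - 4 * fps_X) ^ 3"
    unfolding fps_compose_power[OF z, symmetric] fps_compose_add_distrib
    by (simp add: fps_X_fps_compose_startby0[OF z])
  also have "\<dots> = (?s ^ 3) ^ 2" unfolding sqrt_av_gf[symmetric] by (simp flip: power_mult)
  finally have "?b = ?s ^ 3 \<or> ?b = - (?s ^ 3)" by (simp only: power2_eq_iff)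
  moreover have "?b \<noteq> - (?s ^ 3)"
  proof
    assume "?b = - (?s ^ 3)"
    from arg_cong[OF this, of "\<lambda>f. f $ 0"] have "?b $ 0 = - ((?s ^ 3) $ 0)" by simp
    moreover have "?b $ 0 = 1" by (simp add: one_minus_4x_pow_three_halves_def)
    moreover have "(?s ^ 3) $ 0 = 1" by (simp add: fps_power_zeroth)
    ultimately show False by simp
  qed
  ultimately show ?thesis by blast
qed

text \<open>The recurrence is linear in the unknown series, with coefficient
  \<open>s = 1 - 2 x C\<close> after collecting terms. Multiplying by \<open>x^2 s^2\<close> clears
  the derivative and absorbs every \<open>C\<close> into \<open>Y = x C\<close>.\<close>

lemma almost_gf_closed_form:
  "almost_gf * (- 2 * fps_X ^ 2 * one_minus_4x_pow_three_halves) =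
    1 - 5 * fps_X - 6 * fps_X ^ 2 + 45 * fps_X ^ 3 - 24 * fps_X ^ 4
      - (1 + fps_X - 4 * fps_X ^ 2 + fps_X ^ 3) * one_minus_4x_pow_three_halves"
proof -
  define C D X :: "real fps" where "C = av_gf" and "D = fps_deriv (fps_X * av_gf)" and "X = fps_X"
  define Y s where "Y = X * C" and "s = 1 - 2 * Y"
  have E: "fps_X * fps_deriv av_gf = D - C" by (simp add: D_def C_def)
  have sD: "s * D = 1" using sqrt_deriv_av_gf by (simp add: s_def Y_def X_def C_def D_def)
  have X: "X = Y - Y * Y" using av_gf_eq unfolding Y_def C_def X_def by algebra
  define K where "K = (D - C * C) + X * (D * (D - C)) + X * ((D - C) * D)
    - X * (X * ((C * C) * ((C * C) * C))) - X * ((C * C - C) * C)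
    - X * (X * ((C * C) * (C * C))) + X * (X * ((C * C) * C))"
  have A: "almost_gf = 1 + X * (2 * (almost_gf * C) - C * C + K)"
    using almost_gf_eq unfolding gf_removable E K_def C_def D_def X_def .
  have "almost_gf * s = 1 + X * (K - C * C)"
    using A unfolding s_def Y_def by algebra
  then have "almost_gf * (X ^ 2 * s ^ 3) = s ^ 2 * (X ^ 2 + X ^ 3 * (K - C * C))" by algebra
  \<comment> \<open>The relation \<open>s * D = 1\<close> removes \<open>D\<close>, and the
    available powers of \<open>X\<close> turn each \<open>C\<close> into \<open>Y\<close>.\<close>
  also have "\<dots> = s ^ 2 * X ^ 2 + X ^ 3 * s - 2 * X * Y ^ 2 * s ^ 2 + 2 * X ^ 4 - 2 * X ^ 3 * Y * s
      - s ^ 2 * (Y ^ 5 + X * Y ^ 3 - X ^ 2 * Y ^ 2 + X * Y ^ 4 - X ^ 2 * Y ^ 3)"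
    using sD unfolding K_def Y_def by algebra
  finally have "almost_gf * (X ^ 2 * s ^ 3) = \<dots>" .
  \<comment> \<open>As \<open>X = Y - Y\<^sup>2\<close> and \<open>s = 1 - 2 Y\<close>, this is an identity between polynomials in \<open>Y\<close>.\<close>
  moreover have "- 2 * (s ^ 2 * X ^ 2 + X ^ 3 * s - 2 * X * Y ^ 2 * s ^ 2 + 2 * X ^ 4 - 2 * X ^ 3 * Y * s
      - s ^ 2 * (Y ^ 5 + X * Y ^ 3 - X ^ 2 * Y ^ 2 + X * Y ^ 4 - X ^ 2 * Y ^ 3)) =
    1 - 5 * X - 6 * X ^ 2 + 45 * X ^ 3 - 24 * X ^ 4 - (1 + X - 4 * X ^ 2 + X ^ 3) * s ^ 3"
    unfolding s_def X by algebra
  ultimately have "almost_gf * (- 2 * X ^ 2 * s ^ 3) =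
    1 - 5 * X - 6 * X ^ 2 + 45 * X ^ 3 - 24 * X ^ 4 - (1 + X - 4 * X ^ 2 + X ^ 3) * s ^ 3"
    by algebra
  then show ?thesis
    unfolding one_minus_4x_pow_three_halves_eq by (simp only: s_def Y_def C_def X_def)
qed

text \<open>The shift from \<open>{1..n}\<close> to \<open>{..<n}\<close> is harmless, since the
  count depends only on the size of the set.\<close>

lemma card_Av_plus1_231: "card (Av_plus1 n [2, 3, 1]) = almost_count n"
proof -
  have "almost_avoids p [2, 3, 1] \<longleftrightarrow> almost_av231 p" if "p \<in> permutations_of_set {1..n}" for p
    using permutations_of_setD(2)[OF that] by (rule almost_avoids_iff)
  then have "Av_plus1 n [2, 3, 1] = {p \<in> permutations_of_set {1..n}. almost_av231 p}"
    unfolding Av_plus1_def by blast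
  then show ?thesis by (simp add: card_almost_av231)
qed

theorem theorem3p6:
  shows "fps_to_fls (Abs_fps (\<lambda>n. real (card (Av_plus1 n [2, 3, 1])))) =
    fps_to_fls (1 - 5 * fps_X - 6 * fps_X ^ 2 + 45 * fps_X ^ 3 - 24 * fps_X ^ 4
      - (1 + fps_X - 4 * fps_X ^ 2 + fps_X ^ 3) * one_minus_4x_pow_three_halves)
    / fps_to_fls (- 2 * fps_X ^ 2 * one_minus_4x_pow_three_halves)"
proof -
  \<comment> \<open>The constant term makes the denominator nonzero. It is a nonunit power series
    because of \<open>x^2\<close>, so the quotient is formed among Laurent series.\<close>
  have "one_minus_4x_pow_three_halves $ 0 = 1" by (simp add: one_minus_4x_pow_three_halves_def)
  then have "one_minus_4x_pow_three_halves \<noteq> 0" by auto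
  then have nz: "fps_to_fls (- 2 * fps_X ^ 2 * one_minus_4x_pow_three_halves) \<noteq> 0" by simp
  show ?thesis
    unfolding card_Av_plus1_231 almost_gf_def[symmetric] almost_gf_closed_form[symmetric]
      fls_times_fps_to_fls[of almost_gf]
    by (rule nonzero_mult_div_cancel_right[OF nz, symmetric])
qed

end
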